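(* Let $d\ge1$ and $\alpha=(\alpha_1,\dots,\alpha_d)\in[0,1]^d$, let $K_\alpha=[0,1)^d-\alpha$, and let $T_\alpha:K_\alpha\to K_\alpha$ be defined (away from points with a zero coordinate) by $T_\alpha(x)=1/x-\lfloor 1/x+\alpha\rfloor$, where all operations are coordinate-wise. Then $T_\alpha$ is exact with respect to a finite invariant measure (equivalent to Lebesgue measure on $K_\alpha$). Moreover, every completely irrational point of $K_\alpha$ (i.e. every point all of whose coordinates are irrational) has an infinite, convergent continued fraction expansion.
   Context: On $\mathbb R^d$ all operations are coordinate-wise: $1/x=(1/x_1,\dots,1/x_d)$ when no coordinate vanishes, and $\lfloor x\rfloor=(\lfloor x_1\rfloor,\dots,\lfloor x_d\rfloor)$. Let $\mathcal N$ be the set of points with at least one zero coordinate. For $x\in K_\alpha$ the digits are $a_i=\lfloor 1/T_\alpha^{i-1}(x)+\alpha\rfloor\in\mathbb Z^d$, defined as long as $T_\alpha^{i-1}(x)\notin\mathcal N$. The expansion is infinite if $T_\alpha^n(x)\notin\mathcal N$ for all $n\ge 0$, and it is convergent if $\lim_{n\to\infty}1/(a_1+1/(a_2+\cdots+1/a_n))=x$ in the Euclidean topology (finite fractions being evaluated coordinate-wise, in $\mathbb R\cup\{\infty\}$ if necessary). A map $T$ preserving a probability measure $\mu$ is exact if $\mu(A)>0$ implies $\lim_{n\to\infty}\mu(T^nA)=1$; equivalently, every set in $\bigcap_{n>0}T^{-n}\mathcal M$ is null or co-null, where $\mathcal M$ is the $\sigma$-algebra of measurable sets. A finite invariant measure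 is normalized to be a probability measure. Equivalence of $\mu$ to Lebesgue measure $\mu_L$ is meant in the sense that $C^{-1}\mu\le\mu_L\le C\mu$ for some $C\ge1$. *)

theory Defs
  imports "HOL-Probability.Probability"
begin

definition K :: "real^'n \<Rightarrow> (real^'n) set" where
  "K \<alpha> = (\<lambda>y. y - \<alpha>) ` {y. \<forall>i. y $ i \<in> {0..<1}}"

definition zero_coord :: "(real^'n) set" where
  "zero_coord = {x. \<exists>i. x $ i = 0}"

definition next_digit :: "real^'n \<Rightarrow> real^'n \<Rightarrow> int^'n" where
  "next_digit \<alpha> x = (\<chi> i. \<lfloor>1 / x $ i + \<alpha> $ i\<rfloor>)"

text \<open>
  The map is meant only off \<^const>\<open>zero_coord\<close>. There the convention \<open>1 / 0 = 0\<close> merely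
  provides a total self-map of \<open>K \<alpha>\<close>; it sends \<open>K \<alpha> \<inter> zero_coord\<close> into itself, a Lebesgue null
  set, so it affects neither invariance nor the measure of forward images.
\<close>

definition T :: "real^'n \<Rightarrow> real^'n \<Rightarrow> real^'n" where
  "T \<alpha> x = (\<chi> i. 1 / x $ i - of_int (next_digit \<alpha> x $ i))"

text \<open>\<open>digit \<alpha> x k\<close> is the digit usually written \<open>a\<close> with index \<open>k + 1\<close>.\<close>

definition digit :: "real^'n \<Rightarrow> real^'n \<Rightarrow> nat \<Rightarrow> int^'n" where
  "digit \<alpha> x k = next_digit \<alpha> ((T \<alpha> ^^ k) x)"

definition infinite_expansion :: "real^'n \<Rightarrow> real^'n \<Rightarrow> bool" where
  "infinite_expansion \<alpha> x \<longleftrightarrow> (\<forall>n. (T \<alpha> ^^ n) x \<notin> zero_coord)"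

text \<open>
  Finite fractions \<open>1/(a1 + 1/(a2 + ... + 1/an))\<close> take values in the reals with one point
  \<open>\<infinity>\<close> added. In \<^typ>\<open>ereal\<close> we have \<open>1 / 0 = \<infinity>\<close>, \<open>1 / \<infinity> = 0\<close> and \<open>a + \<infinity> = \<infinity>\<close>, so this is the
  intended arithmetic and the value \<open>-\<infinity>\<close> never arises. Convergence in \<^typ>\<open>ereal\<close> to a real
  limit means being eventually finite and converging in the usual sense.
\<close>

fun finite_fraction :: "int list \<Rightarrow> ereal" where
  "finite_fraction [] = 0"
| "finite_fraction (a # as) = 1 / (ereal (of_int a) + finite_fraction as)"

definition convergent_expansion :: "real^'n \<Rightarrow> real^'n \<Rightarrow> bool" where
  "convergent_expansion \<alpha> x \<longleftrightarrow>
     (\<lambda>n. \<chi> i. finite_fraction (map (\<lambda>k. digit \<alpha> x k $ i) [0..<n])) \<longlonglongrightarrow> (\<chi> i. ereal (x $ i))"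

definition invariant_measure :: "'a measure \<Rightarrow> ('a \<Rightarrow> 'a) \<Rightarrow> bool" where
  "invariant_measure M f \<longleftrightarrow>
     f \<in> measurable M M \<and> (\<forall>A\<in>sets M. emeasure M (f -` A \<inter> space M) = emeasure M A)"

text \<open>
  Measures vanish on non-measurable sets, so the limit in particular requires the forward images
  to be measurable from some \<open>n\<close> on.
\<close>

definition exact :: "'a measure \<Rightarrow> ('a \<Rightarrow> 'a) \<Rightarrow> bool" where
  "exact M f \<longleftrightarrow> prob_space M \<and> invariant_measure M f \<and>
     (\<forall>A\<in>sets M. measure M A > 0 \<longrightarrow> (\<lambda>n. measure M ((f ^^ n) ` A)) \<longlonglongrightarrow> 1)"

text \<open>Two-sided domination, which is stronger than having the same null sets.\<close>

definition equivalent_measures :: "'a measure \<Rightarrow> 'a measure \<Rightarrow> bool" where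
  "equivalent_measures M N \<longleftrightarrow> sets M = sets N \<and>
     (\<exists>C\<ge>1. \<forall>A\<in>sets M. ennreal (1 / C) * emeasure M A \<le> emeasure N A
                       \<and> emeasure N A \<le> ennreal C * emeasure M A)"

end

theory Submission
  imports Defs
begin

text \<open>
  The map acts coordinatewise, so everything rests on the one-dimensional map \<open>tau \<alpha>\<close>. If a point
  and its image are \<open>x\<close> and \<open>y\<close>, then \<open>\<bar>x * y\<bar> \<le> \<rho>\<close> with \<open>\<rho> \<le> 1 / 2\<close>, hence inverse branches of order \<open>k\<close>
  contract like \<open>\<rho> ^ k\<close> and have bounded distortion. Call a cylinder full if it is mapped onto the
  whole interval; a word is bad if no nonempty prefix of it is full. At most \<open>2 ^ k\<close> words of length \<open>k\<close>
  are bad (none with \<open>k > 0\<close> if \<open>\<alpha> \<in> {0, 1}\<close>), and \<open>\<rho> < 1 / 2\<close> otherwise, so their total weight is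
  summable. Splitting a word after its longest full prefix shows that preimages of a set \<open>B\<close> have measure
  at most \<open>C * \<lambda> B\<close>, and that full cylinders of every order carry a definite share of the mass;
  consequently \<open>c * \<lambda> Q * \<lambda> B \<le> \<lambda> (Q \<inter> T ^^ n -` B)\<close> for every interval \<open>Q\<close> and all large \<open>n\<close>.

  Both estimates pass to products. The first makes a cluster point of the Cesaro averages of the
  iterated images of Lebesgue measure an invariant measure dominated by it; the second, with the whole
  space as \<open>Q\<close>, gives the converse domination. Applied to a
  box \<open>Q\<close> almost filled by \<open>A\<close> and to the complement \<open>B\<close> of the \<open>n\<close>-th image of \<open>A\<close>, gives exactness.

  For the expansions, \<open>\<bar>q * x - p\<bar>\<close> is the product of the moduli of the first points of the orbit, which
  tends to \<open>0\<close>, and \<open>q\<close> is a nonzero integer.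
\<close>

section \<open>Cylinders of the one-dimensional map\<close>

definition tau :: "real \<Rightarrow> real \<Rightarrow> real" where
  "tau \<alpha> x = 1 / x - of_int \<lfloor>1 / x + \<alpha>\<rfloor>"

definition Kin :: "real \<Rightarrow> real set" where
  "Kin \<alpha> = {- \<alpha><..<1 - \<alpha>}"

primrec branch :: "int list \<Rightarrow> real \<Rightarrow> real" where
  "branch [] y = y"
| "branch (a # w) y = 1 / (of_int a + branch w y)"

text \<open>The square of \<open>jac w y\<close> is the modulus of the derivative of \<open>branch w\<close> at \<open>y\<close>.\<close>

primrec jac :: "int list \<Rightarrow> real \<Rightarrow> real" where
  "jac [] y = 1"
| "jac (a # w) y = \<bar>branch (a # w) y\<bar> * jac w y"

text \<open>Up to null sets, \<open>tails \<alpha> w\<close> is the image of the cylinder of \<open>w\<close> under the iterate of order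
  \<open>length w\<close>. Working with the open interval \<open>Kin \<alpha>\<close> throughout discards the endpoints, so that
  a cylinder is full exactly when its set of tails is all of \<open>Kin \<alpha>\<close>.\<close>

primrec tails :: "real \<Rightarrow> int list \<Rightarrow> real set" where
  "tails \<alpha> [] = Kin \<alpha>"
| "tails \<alpha> (a # w) = {y \<in> tails \<alpha> w. of_int a + branch w y \<noteq> 0 \<and> branch (a # w) y \<in> Kin \<alpha>}"

text \<open>Phrased through the forward iterate, so that measurability follows from that of
  \<open>tau\<close> and \<open>branch\<close>; \<open>cylinder_conv\<close> recovers the
  description as an image of \<open>tails\<close>.\<close>

definition cylinder :: "real \<Rightarrow> int list \<Rightarrow> real set" where
  "cylinder \<alpha> w = {x. (tau \<alpha> ^^ length w) x \<in> tails \<alpha> w \<and> branch w ((tau \<alpha> ^^ length w) x) = x}"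

definition full :: "real \<Rightarrow> int list \<Rightarrow> bool" where
  "full \<alpha> w \<longleftrightarrow> tails \<alpha> w = Kin \<alpha>"

definition bad :: "real \<Rightarrow> nat \<Rightarrow> int list set" where
  "bad \<alpha> k = {v. length v = k \<and> tails \<alpha> v \<noteq> {} \<and> (\<forall>j\<in>{1..k}. \<not> full \<alpha> (take j v))}"

text \<open>An upper bound for the modulus of \<open>x * tau \<alpha> x\<close>; being below \<open>1 / 2\<close> for \<open>\<alpha>\<close> in the open unit
  interval, it beats the growth \<open>2 ^ k\<close> of the number of bad words.\<close>

definition contraction :: "real \<Rightarrow> real" where
  "contraction \<alpha> = max \<alpha> (1 - \<alpha>) / (1 + max \<alpha> (1 - \<alpha>))"

lemma tau_range: "tau \<alpha> x \<in> {- \<alpha>..<1 - \<alpha>}"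
  unfolding tau_def using floor_correct[of "1 / x + \<alpha>"] by simp linarith

lemma branch_append: "branch (u @ v) y = branch u (branch v y)"
  by (induction u) auto

lemma tails_subset: "tails \<alpha> w \<subseteq> Kin \<alpha>"
  by (induction w) auto

lemma branch_in_Kin: "y \<in> tails \<alpha> w \<Longrightarrow> branch w y \<in> Kin \<alpha>"
  by (cases w) auto

lemma tails_append: "y \<in> tails \<alpha> (u @ v) \<longleftrightarrow> y \<in> tails \<alpha> v \<and> branch v y \<in> tails \<alpha> u"
  by (induction u) (auto simp: branch_append branch_in_Kin)

text \<open>After a full prefix the past is forgotten: \<open>branch v y\<close> must lie in
  \<open>tails \<alpha> u\<close>, which is now all of \<open>Kin \<alpha>\<close>, where it lies
  anyway. In particular full words are closed under concatenation.\<close>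

lemma tails_full_append: "full \<alpha> u \<Longrightarrow> tails \<alpha> (u @ v) = tails \<alpha> v"
  unfolding full_def by (auto simp: tails_append branch_in_Kin)

lemma tau_branch:
  assumes "of_int a + t \<noteq> 0" "t \<in> {-\<alpha>..<1 - \<alpha>}"
  shows "tau \<alpha> (1 / (of_int a + t)) = t" "\<lfloor>1 / (1 / (of_int a + t)) + \<alpha>\<rfloor> = a"
proof -
  have "\<lfloor>of_int a + t + \<alpha>\<rfloor> = a" using assms(2) by (simp add: floor_eq_iff)
  thus "tau \<alpha> (1 / (of_int a + t)) = t" "\<lfloor>1 / (1 / (of_int a + t)) + \<alpha>\<rfloor> = a"
    by (simp_all add: tau_def)
qed

lemma tau_pow_branch: "y \<in> tails \<alpha> w \<Longrightarrow> (tau \<alpha> ^^ length w) (branch w y) = y"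
proof (induction w)
  case (Cons a w)
  have "branch w y \<in> Kin \<alpha>" using Cons.prems branch_in_Kin by auto
  hence "tau \<alpha> (branch (a # w) y) = branch w y"
    using Cons.prems by (simp add: tau_branch Kin_def)
  thus ?case using Cons by (simp add: funpow_swap1[symmetric] funpow_Suc_right del: funpow.simps)
qed simp

text \<open>Converts a preimage inside a cylinder into the image under one injective smooth branch,
  to which the change of variables formula applies.\<close>

lemma cylinder_Int_vimage: "cylinder \<alpha> w \<inter> (tau \<alpha> ^^ length w) -` B = branch w ` (B \<inter> tails \<alpha> w)"
proof (intro subset_antisym subsetI)
  fix x assume "x \<in> cylinder \<alpha> w \<inter> (tau \<alpha> ^^ length w) -` B"
  thus "x \<in> branch w ` (B \<inter> tails \<alpha> w)"
    unfolding cylinder_def by (intro image_eqI[of _ _ "(tau \<alpha> ^^ length w) x"]) auto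
qed (auto simp: cylinder_def tau_pow_branch)

lemma cylinder_conv: "cylinder \<alpha> w = branch w ` tails \<alpha> w"
  using cylinder_Int_vimage[of \<alpha> w UNIV] by simp

lemma cylinder_subset: "cylinder \<alpha> w \<subseteq> Kin \<alpha>"
  unfolding cylinder_conv using branch_in_Kin by auto

lemma cylinder_append: "cylinder \<alpha> (u @ v) = cylinder \<alpha> u \<inter> (tau \<alpha> ^^ length u) -` cylinder \<alpha> v" 
proof -
  have "cylinder \<alpha> (u @ v) \<subseteq> cylinder \<alpha> u \<inter> (tau \<alpha> ^^ length u) -` cylinder \<alpha> v"
    unfolding cylinder_conv by (auto simp: tails_append branch_append tau_pow_branch)
  moreover have "x \<in> cylinder \<alpha> (u @ v)" if x: "x \<in> cylinder \<alpha> u" "(tau \<alpha> ^^ length u) x \<in> cylinder \<alpha> v" for x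
  proof -
    let ?t = "(tau \<alpha> ^^ length u) x"
    have "(tau \<alpha> ^^ (length v + length u)) x = (tau \<alpha> ^^ length v) ?t"
      by (simp only: funpow_add o_apply)
    thus ?thesis using x unfolding cylinder_def by (simp add: tails_append branch_append add.commute)
  qed
  ultimately show ?thesis by auto
qed

section \<open>Recovering digits from points\<close>

definition digit_list :: "real \<Rightarrow> nat \<Rightarrow> real \<Rightarrow> int list" where
  "digit_list \<alpha> n x = map (\<lambda>k. \<lfloor>1 / (tau \<alpha> ^^ k) x + \<alpha>\<rfloor>) [0..<n]"

lemma digit_list_Suc: "digit_list \<alpha> (Suc n) x = \<lfloor>1 / x + \<alpha>\<rfloor> # digit_list \<alpha> n (tau \<alpha> x)"
  unfolding digit_list_def
  by (simp add: upt_conv_Cons map_Suc_upt[symmetric] funpow_Suc_right del: upt_Suc funpow.simps)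

text \<open>Adding a point of \<open>Kin \<alpha>\<close> to an integer does not change the shifted
  floor, so each digit can be read off the orbit. Hence cylinders of distinct words of equal length
  are disjoint.\<close>

lemma cylinder_digit_list: "x \<in> cylinder \<alpha> w \<Longrightarrow> w = digit_list \<alpha> (length w) x"
proof (induction w arbitrary: x)
  case (Cons a w)
  then obtain y where y: "y \<in> tails \<alpha> (a # w)" "x = branch (a # w) y"
    by (auto simp: cylinder_conv)
  have K: "branch w y \<in> Kin \<alpha>" using y branch_in_Kin by auto
  have t: "tau \<alpha> x = branch w y" "\<lfloor>1 / x + \<alpha>\<rfloor> = a"
    using tau_branch[of a "branch w y" \<alpha>] K y by (auto simp: Kin_def)
  have "tau \<alpha> x \<in> cylinder \<alpha> w" using y t by (auto simp: cylinder_conv)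
  thus ?case using Cons.IH t by (simp add: digit_list_Suc)
qed (simp add: digit_list_def)

lemma cylinder_digit_list_take: "x \<in> cylinder \<alpha> w \<Longrightarrow> j \<le> length w \<Longrightarrow> take j w = digit_list \<alpha> j x"
  by (subst cylinder_digit_list[of x \<alpha> w]) (simp_all add: digit_list_def take_map)

lemma cylinder_take: "cylinder \<alpha> w \<subseteq> cylinder \<alpha> (take j w)"
  using cylinder_append[of \<alpha> "take j w" "drop j w"] by auto

lemma cylinder_disjoint: "length u = length v \<Longrightarrow> u \<noteq> v \<Longrightarrow> cylinder \<alpha> u \<inter> cylinder \<alpha> v = {}"
  by (metis cylinder_digit_list disjoint_iff)

text \<open>Put \<open>r = max \<alpha> (1 - \<alpha>)\<close>, which bounds both moduli. If |x| is
  at most 1/(1+r), the bound is immediate. Otherwise |x| exceeds 1-r, so x lies on the longer side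
  of the interval, and |1/x| < 1+r forces the digit to be 1 or -1. Then |x y| = 1 - |x|, which is
  below r/(1+r).\<close>

lemma pair_bound:
  assumes \<alpha>: "\<alpha> \<in> {0..1}" and x: "x \<in> {-\<alpha>..1-\<alpha>}" and y: "y \<in> {-\<alpha>..1-\<alpha>}"
    and "\<bar>x\<bar> < 1" "of_int a + y \<noteq> 0" "x = 1 / (of_int a + y)"
  shows "\<bar>x\<bar> * \<bar>y\<bar> \<le> contraction \<alpha>"
proof -
  define r where "r = max \<alpha> (1 - \<alpha>)"
  have r: "1/2 \<le> r" "r \<le> 1" "\<bar>x\<bar> \<le> r" "\<bar>y\<bar> \<le> r"
    using \<alpha> x y unfolding r_def by (auto simp: max_def)
  have r_cases: "r = \<alpha> \<or> r = 1 - \<alpha>" unfolding r_def by auto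
  show ?thesis
  proof (cases "\<bar>x\<bar> \<le> 1 / (1 + r)")
    case True
    have "\<bar>x\<bar> * \<bar>y\<bar> \<le> 1 / (1 + r) * r" by (intro mult_mono True r) (use r in auto)
    thus ?thesis by (simp add: contraction_def r_def)
  next
    case False
    have x0: "x \<noteq> 0" using assms by simp
    have ya: "of_int a + y = 1 / x" using assms by simp
    have rr: "1 - r < 1 / (1 + r)" using r by (simp add: field_simps)
    have "\<bar>1 / x\<bar> > 1" using \<open>\<bar>x\<bar> < 1\<close> x0 by (simp add: divide_simps)
    moreover have "\<bar>1 / x\<bar> < 1 + r" using False r(1) x0 by (simp add: field_simps)
    ultimately have b: "\<bar>of_int a + y\<bar> > 1" "\<bar>of_int a + y\<bar> < 1 + r" using ya by auto
    show ?thesis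
    proof (cases "x > 0")
      case True
      hence "of_int a + y > 0" using ya by simp
      hence b': "of_int a + y > 1" "of_int a + y < 1 + r" using b by auto
      have "r = 1 - \<alpha>" using r_cases False True rr x by auto
      hence "of_int a < (2::real)" "of_int a > (0::real)" using b' y r by auto
      hence "a = 1" by linarith
      hence "x * y = 1 - x" using ya x0 by (simp add: field_simps)
      moreover have "y \<ge> 0" using \<open>a = 1\<close> b' by simp
      ultimately have "\<bar>x\<bar> * \<bar>y\<bar> = 1 - x" using True by simp
      moreover have "1 - 1 / (1 + r) = r / (1 + r)" using r by (simp add: field_simps)
      ultimately show ?thesis using False True by (simp add: contraction_def r_def)
    next
      case False': False
      hence xn: "x < 0" using x0 by simp
      hence "of_int a + y < 0" using ya by simp
      hence b': "of_int a + y < -1" "of_int a + y > -1 - r" using b by auto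
      have "r = \<alpha>" using r_cases False xn rr x by auto
      hence "of_int a < (0::real)" "of_int a > (-2::real)" using b' y r by auto
      hence "a = -1" by linarith
      hence "x * y = 1 + x" using ya x0 by (simp add: field_simps)
      moreover have "y \<le> 0" using \<open>a = -1\<close> b' by simp
      ultimately have "\<bar>x\<bar> * \<bar>y\<bar> = 1 + x" using xn by simp
      moreover have "1 - 1 / (1 + r) = r / (1 + r)" using r by (simp add: field_simps)
      ultimately show ?thesis using False xn by (simp add: contraction_def r_def)
    qed
  qed
qed

lemma contraction_bounds:
  assumes "\<alpha> \<in> {0..1}"
  shows "1 / 3 \<le> contraction \<alpha>" "contraction \<alpha> \<le> 1 / 2" "\<alpha> \<in> {0<..<1} \<Longrightarrow> contraction \<alpha> < 1 / 2"
proof -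
  define r where "r = max \<alpha> (1 - \<alpha>)"
  have r: "1/2 \<le> r" "r \<le> 1" "\<alpha> \<in> {0<..<1} \<Longrightarrow> r < 1"
    using assms unfolding r_def by (auto simp: max_def)
  have eq: "contraction \<alpha> = r / (1 + r)" by (simp add: contraction_def r_def)
  show "1 / 3 \<le> contraction \<alpha>" "contraction \<alpha> \<le> 1 / 2" "\<alpha> \<in> {0<..<1} \<Longrightarrow> contraction \<alpha> < 1 / 2"
    unfolding eq using r by (auto simp: divide_simps)
qed

section \<open>Contraction and distortion of inverse branches\<close>

context
  fixes \<alpha> :: real
  assumes \<alpha>: "\<alpha> \<in> {0..1}"
begin

lemma Kin_abs: "x \<in> Kin \<alpha> \<Longrightarrow> \<bar>x\<bar> < 1"
  using \<alpha> unfolding Kin_def by auto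

lemma jac_pos: "y \<in> tails \<alpha> w \<Longrightarrow> jac w y > 0"
  by (induction w) auto

text \<open>\<open>(jac w y)\<^sup>2\<close> is a product of squared moduli of orbit points.
  Regrouping it into products of neighbours leaves one factor at each end; the last is at most 1,
  and the first is kept in the bound so that the induction can pair it with the next point
  prepended.\<close>

lemma jac_sq_aux:
  "w \<noteq> [] \<Longrightarrow> y \<in> tails \<alpha> w \<Longrightarrow> (jac w y)\<^sup>2 \<le> \<bar>branch w y\<bar> * contraction \<alpha> ^ (length w - 1)"
proof (induction w)
  case (Cons a w)
  let ?x = "branch (a # w) y" and ?t = "branch w y"
  have x: "?x \<in> Kin \<alpha>" and t: "?t \<in> Kin \<alpha>" using Cons.prems branch_in_Kin by auto
  show ?case
  proof (cases "w = []")
    case True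
    have "\<bar>?x\<bar> * \<bar>?x\<bar> \<le> \<bar>?x\<bar> * 1" using Kin_abs[OF x] by (intro mult_left_mono) auto
    thus ?thesis using True by (simp add: power2_eq_square)
  next
    case False
    have p: "\<bar>?x\<bar> * \<bar>?t\<bar> \<le> contraction \<alpha>"
      using Kin_abs[OF x] x t Cons.prems by (intro pair_bound[OF \<alpha>, of _ _ a]) (auto simp: Kin_def)
    have "(jac (a # w) y)\<^sup>2 = \<bar>?x\<bar> * \<bar>?x\<bar> * (jac w y)\<^sup>2"
      by (simp add: power2_eq_square)
    also have "\<dots> \<le> \<bar>?x\<bar> * \<bar>?x\<bar> * (\<bar>?t\<bar> * contraction \<alpha> ^ (length w - 1))"
      using Cons False by (intro mult_left_mono) auto
    also have "\<dots> = \<bar>?x\<bar> * ((\<bar>?x\<bar> * \<bar>?t\<bar>) * contraction \<alpha> ^ (length w - 1))" by simp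
    also have "\<dots> \<le> \<bar>?x\<bar> * (contraction \<alpha> * contraction \<alpha> ^ (length w - 1))"
      using p contraction_bounds(1)[OF \<alpha>] by (intro mult_left_mono mult_right_mono) auto
    also have "contraction \<alpha> * contraction \<alpha> ^ (length w - 1) = contraction \<alpha> ^ length w"
      using False by (cases w) auto
    finally show ?thesis by simp
  qed
qed simp

text \<open>The factor 3 pays for raising the exponent by one, because
  \<open>contraction \<alpha>\<close> is at least 1/3.\<close>

lemma jac_sq_le:
  assumes "y \<in> tails \<alpha> w"
  shows "(jac w y)\<^sup>2 \<le> 3 * contraction \<alpha> ^ length w"
proof (cases w)
  case (Cons a v)
  have c: "contraction \<alpha> \<ge> 1 / 3" using contraction_bounds[OF \<alpha>] by simp
  have "(jac w y)\<^sup>2 \<le> \<bar>branch w y\<bar> * contraction \<alpha> ^ length v"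
    using jac_sq_aux[of w y] assms Cons by simp
  also have "\<dots> \<le> (3 * contraction \<alpha>) * contraction \<alpha> ^ length v"
    using Kin_abs[OF branch_in_Kin[OF assms]] c by (intro mult_right_mono) auto
  finally show ?thesis using Cons by simp
qed simp

text \<open>For Moebius maps the mean value theorem becomes an identity, with the geometric mean of
  the derivatives at the two points as its factor.\<close>

lemma branch_diff:
  "y \<in> tails \<alpha> w \<Longrightarrow> z \<in> tails \<alpha> w \<Longrightarrow> \<bar>branch w y - branch w z\<bar> = jac w y * jac w z * \<bar>y - z\<bar>"
proof (induction w)
  case (Cons a w)
  have "branch (a # w) y - branch (a # w) z = - (branch (a # w) y * branch (a # w) z * (branch w y - branch w z))"
    using Cons.prems by (simp add: divide_simps)
  hence "\<bar>branch (a # w) y - branch (a # w) z\<bar> = \<bar>branch (a # w) y\<bar> * \<bar>branch (a # w) z\<bar> * \<bar>branch w y - branch w z\<bar>"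
    by (simp only: abs_mult abs_minus_cancel)
  thus ?case using Cons by simp
qed simp

lemma branch_diff_le:
  assumes "y \<in> tails \<alpha> w" "z \<in> tails \<alpha> w"
  shows "\<bar>branch w y - branch w z\<bar> \<le> 3 * contraction \<alpha> ^ length w"
proof -
  have "2 * (jac w y * jac w z) \<le> (jac w y)\<^sup>2 + (jac w z)\<^sup>2"
    using zero_le_power2[of "jac w y - jac w z"] by (simp add: power2_eq_square algebra_simps)
  hence *: "jac w y * jac w z \<le> 3 * contraction \<alpha> ^ length w"
    using jac_sq_le[OF assms(1)] jac_sq_le[OF assms(2)] by linarith
  have "y \<in> Kin \<alpha>" "z \<in> Kin \<alpha>" using assms tails_subset by auto
  hence "\<bar>y - z\<bar> \<le> 1" unfolding Kin_def by auto
  hence "jac w y * jac w z * \<bar>y - z\<bar> \<le> jac w y * jac w z * 1"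
    using jac_pos[OF assms(1)] jac_pos[OF assms(2)] by (intro mult_left_mono) auto
  thus ?thesis using * branch_diff[OF assms] by simp
qed

lemma cylinder_diam: "x \<in> cylinder \<alpha> w \<Longrightarrow> x' \<in> cylinder \<alpha> w \<Longrightarrow> \<bar>x - x'\<bar> \<le> 3 * contraction \<alpha> ^ length w"
  unfolding cylinder_conv using branch_diff_le by auto

text \<open>The leading factors at y and z have ratio 1 - x (y' - z'), with x the outer point of y
  and y', z' the next points. As |x| < 1, it is at most 1 + |y' - z'|, and the distances |y' - z'|
  decay geometrically with the length of the remaining word.\<close>

lemma jac_distortion_aux:
  "y \<in> tails \<alpha> w \<Longrightarrow> z \<in> tails \<alpha> w \<Longrightarrow> jac w y \<le> exp (\<Sum>i<length w. 3 * contraction \<alpha> ^ i) * jac w z"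
proof (induction w)
  case (Cons a w)
  let ?e = "3 * contraction \<alpha> ^ length w"
  have yz: "y \<in> tails \<alpha> w" "z \<in> tails \<alpha> w" using Cons.prems by auto
  have nz: "of_int a + branch w y \<noteq> 0" "of_int a + branch w z \<noteq> 0" using Cons.prems by auto
  have "branch (a # w) y = branch (a # w) z * (1 - branch (a # w) y * (branch w y - branch w z))"
    using nz by (simp add: field_simps)
  hence eq: "\<bar>branch (a # w) y\<bar> = \<bar>branch (a # w) z\<bar> * \<bar>1 - branch (a # w) y * (branch w y - branch w z)\<bar>"
    by (metis abs_mult)
  have "\<bar>1 - branch (a # w) y * (branch w y - branch w z)\<bar> \<le> 1 + \<bar>branch (a # w) y\<bar> * \<bar>branch w y - branch w z\<bar>"
    unfolding abs_mult[symmetric] by linarith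
  also have "\<dots> \<le> 1 + 1 * ?e"
    using Kin_abs[of "branch (a # w) y"] Cons.prems branch_diff_le[OF yz]
    by (intro add_left_mono mult_mono) auto
  also have "\<dots> \<le> exp ?e" using exp_ge_add_one_self[of ?e] by simp
  finally have "\<bar>1 - branch (a # w) y * (branch w y - branch w z)\<bar> \<le> exp ?e" .
  hence 1: "\<bar>branch (a # w) y\<bar> \<le> \<bar>branch (a # w) z\<bar> * exp ?e"
    unfolding eq by (intro mult_left_mono) auto
  have "\<bar>branch (a # w) y\<bar> * jac w y
      \<le> (\<bar>branch (a # w) z\<bar> * exp ?e) * (exp (\<Sum>i<length w. 3 * contraction \<alpha> ^ i) * jac w z)"
    using 1 Cons.IH[OF yz] jac_pos[OF yz(1)] by (intro mult_mono) auto
  thus ?case by (simp add: exp_add mult_ac)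
qed simp

lemma jac_distortion:
  assumes "y \<in> tails \<alpha> w" "z \<in> tails \<alpha> w"
  shows "jac w y \<le> exp 6 * jac w z"
proof -
  \<comment> \<open>The ratio is at most 1/2, so the geometric sum is at most 2, and 3 times 2 gives
    the exponent 6.\<close>
  have "(\<Sum>i<n. 3 * contraction \<alpha> ^ i) \<le> 6" for n
  proof -
    have c: "0 \<le> contraction \<alpha>" "contraction \<alpha> \<le> 1 / 2" using contraction_bounds[OF \<alpha>] by auto
    have "(\<Sum>i<n. contraction \<alpha> ^ i) \<le> (\<Sum>i<n. (1 / 2) ^ i)"
      using c by (intro sum_mono power_mono) auto
    also have "\<dots> \<le> 2" using sum_gp_strict[of "1 / 2 :: real" n] by simp
    finally show ?thesis by (simp add: sum_distrib_left[symmetric])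
  qed
  hence "exp (\<Sum>i<length w. 3 * contraction \<alpha> ^ i) * jac w z \<le> exp 6 * jac w z"
    using jac_pos[OF assms(2)] by (intro mult_right_mono) auto
  thus ?thesis using jac_distortion_aux[OF assms] by linarith
qed

text \<open>A reciprocal in \<open>Kin \<alpha>\<close> forces modulus above 1, so two such points
  at distance below 1 cannot have 0 between them. Inversion is therefore monotone between
  them.\<close>

lemma step_same_sign:
  assumes "u1 < u2" "u2 - u1 < 1" "u1 \<noteq> 0" "u2 \<noteq> 0" "1 / u1 \<in> Kin \<alpha>" "1 / u2 \<in> Kin \<alpha>"
  shows "0 < u1 \<or> u2 < 0"
proof (rule ccontr)
  assume "\<not> (0 < u1 \<or> u2 < 0)"
  hence s: "u1 < 0" "u2 > 0" using assms by auto
  have "\<bar>1 / u2\<bar> < 1" using Kin_abs assms by blast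
  hence "u2 > 1" using s by (simp add: field_simps)
  thus False using s assms by linarith
qed

text \<open>The induction appends digits at the end: \<open>tails \<alpha> (w @ [a])\<close> is the
  part of \<open>Kin \<alpha>\<close> sent into \<open>tails \<alpha> w\<close> by inversion after
  translation by a, and inversion is monotone there by \<open>step_same_sign\<close>.\<close>

lemma is_interval_tails: "is_interval (tails \<alpha> w)"
proof (induction w rule: rev_induct)
  case (snoc a w)
  show ?case unfolding is_interval_1
  proof (intro allI ballI impI)
    fix y1 y2 y
    assume y: "y1 \<in> tails \<alpha> (w @ [a])" "y2 \<in> tails \<alpha> (w @ [a])" "y1 \<le> y \<and> y \<le> y2"
    have m: "z \<in> tails \<alpha> (w @ [a]) \<longleftrightarrow> z \<in> Kin \<alpha> \<and> of_int a + z \<noteq> 0 \<and> 1 / (of_int a + z) \<in> tails \<alpha> w" for z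
      using tails_append[of z \<alpha> w "[a]"] tails_subset[of \<alpha> w] by auto
    show "y \<in> tails \<alpha> (w @ [a])"
    proof (cases "y1 < y \<and> y < y2")
      case True
      let ?u1 = "of_int a + y1" and ?u2 = "of_int a + y2" and ?u = "of_int a + y"
      have K: "y1 \<in> Kin \<alpha>" "y2 \<in> Kin \<alpha>" using y m by auto
      have s: "0 < ?u1 \<or> ?u2 < 0"
        using y True m K tails_subset[of \<alpha> w] by (intro step_same_sign) (auto simp: Kin_def)
      have "1 / ?u2 \<le> 1 / ?u" "1 / ?u \<le> 1 / ?u1"
        using s True by (auto simp: divide_simps)
      hence "1 / ?u \<in> tails \<alpha> w"
        using snoc y(1,2) m unfolding is_interval_1 by blast
      moreover have "?u \<noteq> 0" using s True by auto
      moreover have "y \<in> Kin \<alpha>" using K True unfolding Kin_def by auto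
      ultimately show ?thesis using m by auto
    qed (use y in auto)
  qed
qed (auto simp: is_interval_1 Kin_def)

lemma tails_snoc: "z \<in> tails \<alpha> (w @ [a]) \<longleftrightarrow> z \<in> Kin \<alpha> \<and> of_int a + z \<noteq> 0 \<and> 1 / (of_int a + z) \<in> tails \<alpha> w"
  using tails_append[of z \<alpha> w "[a]"] tails_subset[of \<alpha> w] by auto

text \<open>A child of the interval \<open>tails \<alpha> v\<close> that is neither empty nor full must contain the reciprocal
  of one of its endpoints, which leaves two candidates for the digit.\<close>

lemma nonfull_child:
  assumes ne: "tails \<alpha> (v @ [a]) \<noteq> {}" and nf: "\<not> full \<alpha> (v @ [a])"
  shows "a \<in> {\<lfloor>1 / Inf (tails \<alpha> v) + \<alpha>\<rfloor>, \<lfloor>1 / Sup (tails \<alpha> v) + \<alpha>\<rfloor>}"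
proof -
  let ?J = "tails \<alpha> v"
  obtain y1 where y1: "y1 \<in> tails \<alpha> (v @ [a])" using ne by auto
  obtain y2 where y2: "y2 \<in> Kin \<alpha>" "y2 \<notin> tails \<alpha> (v @ [a])"
    using nf tails_subset unfolding full_def by blast
  let ?u1 = "of_int a + y1" and ?u2 = "of_int a + y2"
  have K: "y1 \<in> Kin \<alpha>" "?u1 \<noteq> 0" "1 / ?u1 \<in> ?J" using y1 tails_snoc by auto
  have J: "?u2 = 0 \<or> 1 / ?u2 \<notin> ?J" using y2 tails_snoc by auto
  have b1: "-1 < t \<and> t < 1" if "t \<in> ?J" for t
    using that tails_subset[of \<alpha> v] Kin_abs by force
  have bdd: "bdd_above ?J" "bdd_below ?J"
    using b1 by (auto intro!: bdd_aboveI[of _ 1] bdd_belowI[of _ "-1"] less_imp_le)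
  have S1: "1 / ?u1 \<le> Sup ?J" "Inf ?J \<le> 1 / ?u1"
    using K(3) bdd by (auto intro: cSup_upper cInf_lower)
  have S2: "Sup ?J \<le> 1" using b1 K(3) by (intro cSup_least) (auto intro: less_imp_le)
  have S3: "-1 \<le> Inf ?J" using b1 K(3) by (intro cInf_greatest) (auto intro: less_imp_le)
  note S = S1 S2 S3
  have i: "t \<in> ?J" if "s \<in> ?J" "s' \<in> ?J" "s \<le> t" "t \<le> s'" for s s' t
    using is_interval_tails[of v] that unfolding is_interval_1 by blast
  have key: "\<lfloor>s + \<alpha>\<rfloor> = a" if "s \<in> {?u1..?u2} \<or> s \<in> {?u2..?u1}" for s
    using that K(1) y2(1) unfolding Kin_def by (auto simp: floor_eq_iff)
  have u1: "\<bar>?u1\<bar> > 1"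
  proof -
    have "\<bar>1 / ?u1\<bar> < 1" using b1[OF K(3)] by linarith
    thus ?thesis using K(2) by (simp add: divide_simps)
  qed
  have d: "\<bar>?u1 - ?u2\<bar> < 1" using K(1) y2(1) unfolding Kin_def by auto
  have nJ: "1 / ?u2 \<notin> ?J" using J u1 d by auto
  have ne: "1 / ?u1 \<noteq> 1 / ?u2" using nJ K by auto
  \<comment> \<open>\<open>1 / ?u1\<close> is in the interval \<open>?J\<close> and
    \<open>1 / ?u2\<close> is not, so an endpoint of \<open>?J\<close> lies between them. Inverting
    that endpoint gives a point between \<open>?u1\<close> and \<open>?u2\<close>, to which
    \<open>key\<close> applies.\<close>
  have lo: "1 / ?u2 \<le> Inf ?J" if "1 / ?u2 < 1 / ?u1"
  proof (rule cInf_greatest)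
    fix t assume "t \<in> ?J"
    thus "1 / ?u2 \<le> t" using i[of t "1 / ?u1" "1 / ?u2"] K(3) nJ that by linarith
  qed (use K in auto)
  have hi: "Sup ?J \<le> 1 / ?u2" if "1 / ?u1 < 1 / ?u2"
  proof (rule cSup_least)
    fix t assume "t \<in> ?J"
    thus "t \<le> 1 / ?u2" using i[of "1 / ?u1" t "1 / ?u2"] K(3) nJ that by linarith
  qed (use K in auto)
  have inv_mem: "1 / s \<in> {?u1..?u2} \<or> 1 / s \<in> {?u2..?u1}"
    if s: "s \<in> {1 / ?u1..1 / ?u2} \<or> s \<in> {1 / ?u2..1 / ?u1}" for s
  proof -
    have "?u1 > 0 \<and> ?u2 > 0 \<or> ?u1 < 0 \<and> ?u2 < 0" using u1 d by linarith
    thus ?thesis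
    proof
      assume p: "?u1 > 0 \<and> ?u2 > 0"
      hence "1 / ?u1 > 0" "1 / ?u2 > 0" by auto
      hence "s > 0" using s by (auto simp del: zero_less_divide_1_iff)
      thus ?thesis using s p by (auto simp: field_simps)
    next
      assume p: "?u1 < 0 \<and> ?u2 < 0"
      hence "1 / ?u1 < 0" "1 / ?u2 < 0" by auto
      hence "s < 0" using s by (auto simp del: divide_less_0_1_iff)
      thus ?thesis using s p by (auto simp: field_simps)
    qed
  qed
  show ?thesis
  proof (cases "1 / ?u2 < 1 / ?u1")
    case True
    hence "1 / Inf ?J \<in> {?u1..?u2} \<or> 1 / Inf ?J \<in> {?u2..?u1}"
      using lo S by (intro inv_mem) auto
    thus ?thesis using key by blast
  next
    case False
    hence "1 / Sup ?J \<in> {?u1..?u2} \<or> 1 / Sup ?J \<in> {?u2..?u1}"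
      using hi S ne by (intro inv_mem) auto
    thus ?thesis using key by blast
  qed
qed

end

section \<open>Lebesgue measure and inverse branches\<close>

text \<open>The whole line stays the underlying space, so preimages need no intersection with it.
  Since \<open>Kin \<alpha>\<close> has length 1, this is Lebesgue measure cut down to
  \<open>Kin \<alpha>\<close>, without rescaling.\<close>

definition unif_Kin :: "real \<Rightarrow> real measure" where
  "unif_Kin \<alpha> = uniform_measure lborel (Kin \<alpha>)"

lemma sets_unif_Kin [simp, measurable_cong]: "sets (unif_Kin \<alpha>) = sets borel"
  by (simp add: unif_Kin_def)

lemma space_unif_Kin [simp]: "space (unif_Kin \<alpha>) = UNIV"
  by (simp add: unif_Kin_def)

lemma Kin_borel [measurable, simp]: "Kin \<alpha> \<in> sets borel"
  by (simp add: Kin_def)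

lemma emeasure_Kin: "emeasure lborel (Kin \<alpha>) = 1"
  by (simp add: Kin_def)

lemma emeasure_unif_Kin: "A \<in> sets borel \<Longrightarrow> emeasure (unif_Kin \<alpha>) A = emeasure lborel (Kin \<alpha> \<inter> A)"
  by (simp add: unif_Kin_def emeasure_Kin divide_ennreal_def)

lemma measure_unif_Kin: "A \<in> sets borel \<Longrightarrow> measure (unif_Kin \<alpha>) A = measure lborel (Kin \<alpha> \<inter> A)"
  by (simp add: measure_def emeasure_unif_Kin)

interpretation unif_Kin: prob_space "unif_Kin \<alpha>" for \<alpha>
  unfolding unif_Kin_def by (rule prob_space_uniform_measure) (simp_all add: emeasure_Kin)

lemma tau_measurable [measurable]: "tau \<alpha> \<in> borel_measurable borel"
  unfolding tau_def[abs_def] by measurable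

lemma tau_pow_measurable [measurable]: "(tau \<alpha> ^^ n) \<in> borel_measurable borel"
  by (induction n) (auto intro: measurable_comp)

lemma branch_measurable [measurable]: "branch w \<in> borel_measurable borel"
proof (induction w)
  case (Cons a w)
  have [measurable]: "branch w \<in> borel_measurable borel" by (rule Cons)
  have "branch (a # w) = (\<lambda>y. 1 / (of_int a + branch w y))" by auto
  thus ?case by simp
qed (simp add: measurable_ident[unfolded id_def] cong: measurable_cong)

lemma tails_borel [measurable, simp]: "tails \<alpha> w \<in> sets borel"
proof (induction w)
  case (Cons a w)
  have [measurable]: "tails \<alpha> w \<in> sets borel" by (rule Cons)
  have "tails \<alpha> (a # w) = tails \<alpha> w \<inter> {y. of_int a + branch w y \<noteq> 0} \<inter> branch (a # w) -` Kin \<alpha>"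
    by auto
  also have "\<dots> \<in> sets borel"
    using measurable_sets[OF branch_measurable Kin_borel, of "a # w" \<alpha>] by auto
  finally show ?case .
qed simp

lemma cylinder_borel [measurable, simp]: "cylinder \<alpha> w \<in> sets borel"
proof -
  have "cylinder \<alpha> w = {x \<in> space borel. (tau \<alpha> ^^ length w) x \<in> tails \<alpha> w \<and> branch w ((tau \<alpha> ^^ length w) x) = x}"
    by (simp add: cylinder_def)
  also have "\<dots> \<in> sets borel" by measurable
  finally show ?thesis .
qed

lemma vimage_tau_pow [simp, measurable]: "B \<in> sets borel \<Longrightarrow> (tau \<alpha> ^^ n) -` B \<in> sets borel"
  using measurable_sets[OF tau_pow_measurable, of B] by simp

lemma branch_deriv:
  "y \<in> tails \<alpha> w \<Longrightarrow> (branch w has_field_derivative (- 1) ^ length w * (jac w y)\<^sup>2) (at y within S)"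
proof (induction w)
  case Nil
  have "branch [] = (\<lambda>y. y)" by auto
  thus ?case by simp
next
  case (Cons a w)
  have e: "branch (a # w) = (\<lambda>y. 1 / (of_int a + branch w y))" by auto
  have nz: "of_int a + branch w y \<noteq> 0" using Cons.prems by auto
  have "((\<lambda>y. 1 / (of_int a + branch w y)) has_field_derivative
      - ((- 1) ^ length w * (jac w y)\<^sup>2) / (of_int a + branch w y)\<^sup>2) (at y within S)"
    using Cons nz by (auto intro!: derivative_eq_intros simp: power2_eq_square field_simps)
  moreover have "- ((- 1) ^ length w * (jac w y)\<^sup>2) / (of_int a + branch w y)\<^sup>2
      = (- 1) ^ length (a # w) * (jac (a # w) y)\<^sup>2"
    using nz by (simp add: power_mult_distrib power_divide field_simps)
  ultimately show ?case unfolding e by simp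
qed

lemma branch_inj: "inj_on (branch w) (tails \<alpha> w)"
  by (metis inj_on_def tau_pow_branch)

lemma Kin_sub_lmeasurable:
  assumes "S \<in> sets borel" "S \<subseteq> Kin \<alpha>"
  shows "S \<in> lmeasurable"
proof -
  have "bounded S" using assms(2) bounded_subset[of "Kin \<alpha>"] by (auto simp: Kin_def)
  thus ?thesis using assms(1) by (intro bounded_set_imp_lmeasurable) auto
qed

text \<open>Change of variables for the constant function 1: the branch is injective on its tails,
  with derivative of modulus \<open>(jac w y)\<^sup>2\<close>.\<close>

lemma branch_image_measure:
  assumes S: "S \<in> sets borel" "S \<subseteq> tails \<alpha> w"
  shows "(\<lambda>y. (jac w y)\<^sup>2) integrable_on S"
    and "measure lborel (branch w ` S) = integral S (\<lambda>y. (jac w y)\<^sup>2)"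
proof -
  have "branch w ` S = branch w ` (S \<inter> tails \<alpha> w)" using S by (simp add: Int_absorb2)
  also have "\<dots> = cylinder \<alpha> w \<inter> (tau \<alpha> ^^ length w) -` S" by (simp add: cylinder_Int_vimage)
  finally have b: "branch w ` S \<in> sets borel" using S by simp
  have sub: "branch w ` S \<subseteq> Kin \<alpha>" using S branch_in_Kin by auto
  have lm: "branch w ` S \<in> lmeasurable" using Kin_sub_lmeasurable[OF b sub] .
  have "(\<lambda>x. \<bar>(- 1) ^ length w * (jac w x)\<^sup>2\<bar> * 1) absolutely_integrable_on S \<and>
        integral S (\<lambda>x. \<bar>(- 1) ^ length w * (jac w x)\<^sup>2\<bar> * 1) = integral (branch w ` S) (\<lambda>_. 1 :: real)"
  proof (subst has_absolute_integral_change_of_variables_1'[where g = "branch w"])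
    show "inj_on (branch w) S" using branch_inj S inj_on_subset by blast
    show "(branch w has_field_derivative (- 1) ^ length w * (jac w x)\<^sup>2) (at x within S)" if "x \<in> S" for x
      using branch_deriv that S by blast
    show "(\<lambda>_. 1 :: real) absolutely_integrable_on branch w ` S \<and>
          integral (branch w ` S) (\<lambda>_. 1 :: real) = integral (branch w ` S) (\<lambda>_. 1)"
      using absolutely_integrable_on_const[OF lm, of "1::real"] by blast
  qed (use S in auto)
  hence *: "(\<lambda>x. (jac w x)\<^sup>2) absolutely_integrable_on S"
    "integral S (\<lambda>x. (jac w x)\<^sup>2) = integral (branch w ` S) (\<lambda>_. 1 :: real)"
    by (simp_all add: abs_mult power_abs)
  show "(\<lambda>y. (jac w y)\<^sup>2) integrable_on S"
    using * set_lebesgue_integral_eq_integral(1) by blast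
  show "measure lborel (branch w ` S) = integral S (\<lambda>y. (jac w y)\<^sup>2)"
    using * lmeasure_integral[OF lm] b by simp
qed

lemma branch_image_measure_le:
  assumes S: "S \<in> sets borel" "S \<subseteq> tails \<alpha> w" and c: "\<And>y. y \<in> S \<Longrightarrow> (jac w y)\<^sup>2 \<le> c"
  shows "measure lborel (branch w ` S) \<le> c * measure lborel S"
proof -
  have lm: "S \<in> lmeasurable" using Kin_sub_lmeasurable S tails_subset by blast
  have "integral S (\<lambda>y. (jac w y)\<^sup>2) \<le> integral S (\<lambda>_. c * 1)"
    using c branch_image_measure[OF S] integrable_on_const[OF lm, of "c * 1"] by (intro integral_le) auto
  also have "\<dots> = c * measure lborel S"
    using lmeasure_integral[OF lm] S by (subst integral_mult_right) simp
  finally show ?thesis using branch_image_measure[OF S] by simp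
qed

lemma branch_image_measure_ge:
  assumes S: "S \<in> sets borel" "S \<subseteq> tails \<alpha> w" and c: "\<And>y. y \<in> S \<Longrightarrow> c \<le> (jac w y)\<^sup>2"
  shows "c * measure lborel S \<le> measure lborel (branch w ` S)"
proof -
  have lm: "S \<in> lmeasurable" using Kin_sub_lmeasurable S tails_subset by blast
  have "c * measure lborel S = integral S (\<lambda>_. c * 1)"
    using lmeasure_integral[OF lm] S by (subst integral_mult_right) simp
  also have "\<dots> \<le> integral S (\<lambda>y. (jac w y)\<^sup>2)"
    using c branch_image_measure[OF S] integrable_on_const[OF lm, of "c * 1"] by (intro integral_le) auto
  finally show ?thesis using branch_image_measure[OF S] by simp
qed

lemma measure_cylinder_vimage:
  assumes "B \<in> sets borel"
  shows "measure (unif_Kin \<alpha>) (cylinder \<alpha> w \<inter> (tau \<alpha> ^^ length w) -` B) = measure lborel (branch w ` (B \<inter> tails \<alpha> w))"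
  using assms cylinder_subset[of \<alpha> w] by (subst measure_unif_Kin) (auto simp: cylinder_Int_vimage[symmetric] intro!: arg_cong[where f = "measure lborel"])

lemma measure_unif_Kin_Int_tails: "B \<in> sets borel \<Longrightarrow> measure lborel (B \<inter> tails \<alpha> w) \<le> measure (unif_Kin \<alpha>) B"
  using tails_subset[of \<alpha> w] Kin_sub_lmeasurable[of "Kin \<alpha> \<inter> B" \<alpha>]
  by (subst measure_unif_Kin) (auto intro!: measure_mono_fmeasurable simp: fmeasurable_def emeasure_Kin)

text \<open>Carries an estimate from single cylinders to countable disjoint unions. The sums are
  written as nonnegative integrals over a counting measure, so no summability has to be
  checked.\<close>

lemma (in finite_measure) measure_UN_mono:
  assumes I: "countable I" and X: "\<And>i. i \<in> I \<Longrightarrow> X i \<in> sets M" and disj: "disjoint_family_on X I"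
    and P: "P \<in> sets M" and le: "\<And>i. i \<in> I \<Longrightarrow> c * measure M (X i) \<le> d * measure M (X i \<inter> P)"
    and cd: "c \<ge> 0" "d \<ge> 0"
  shows "c * measure M (\<Union>i\<in>I. X i) \<le> d * measure M ((\<Union>i\<in>I. X i) \<inter> P)"
proof -
  have le': "ennreal c * emeasure M (X i) \<le> ennreal d * emeasure M (X i \<inter> P)" if "i \<in> I" for i
    using le[OF that] cd by (simp add: emeasure_eq_measure ennreal_mult'[symmetric])
  have d2: "disjoint_family_on (\<lambda>i. X i \<inter> P) I" using disj unfolding disjoint_family_on_def by blast
  have "ennreal c * emeasure M (\<Union>i\<in>I. X i) = (\<integral>\<^sup>+i. ennreal c * emeasure M (X i) \<partial>count_space I)"
    using I X disj by (subst emeasure_UN_countable) (auto simp: nn_integral_cmult)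
  also have "\<dots> \<le> (\<integral>\<^sup>+i. ennreal d * emeasure M (X i \<inter> P) \<partial>count_space I)"
    using le' by (intro nn_integral_mono) auto
  also have "\<dots> = ennreal d * emeasure M (\<Union>i\<in>I. X i \<inter> P)"
    using I X d2 P by (subst emeasure_UN_countable) (auto simp: nn_integral_cmult)
  finally show ?thesis
    using cd by (simp add: emeasure_eq_measure ennreal_mult'[symmetric])
qed

lemma (in finite_measure) measure_UN_mono':
  assumes I: "countable I" and X: "\<And>i. i \<in> I \<Longrightarrow> X i \<in> sets M" and disj: "disjoint_family_on X I"
    and P: "P \<in> sets M" and le: "\<And>i. i \<in> I \<Longrightarrow> measure M (X i \<inter> P) \<le> c * measure M (X i)"
    and cd: "c \<ge> 0"
  shows "measure M ((\<Union>i\<in>I. X i) \<inter> P) \<le> c * measure M (\<Union>i\<in>I. X i)"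
proof -
  have le': "emeasure M (X i \<inter> P) \<le> ennreal c * emeasure M (X i)" if "i \<in> I" for i
    using le[OF that] cd by (simp add: emeasure_eq_measure ennreal_mult'[symmetric])
  have d2: "disjoint_family_on (\<lambda>i. X i \<inter> P) I" using disj unfolding disjoint_family_on_def by blast
  have "emeasure M (\<Union>i\<in>I. X i \<inter> P) = (\<integral>\<^sup>+i. emeasure M (X i \<inter> P) \<partial>count_space I)"
    using I X d2 P by (subst emeasure_UN_countable) auto
  also have "\<dots> \<le> (\<integral>\<^sup>+i. ennreal c * emeasure M (X i) \<partial>count_space I)"
    using le' by (intro nn_integral_mono) auto
  also have "\<dots> = ennreal c * emeasure M (\<Union>i\<in>I. X i)"
    using I X disj by (subst emeasure_UN_countable) (auto simp: nn_integral_cmult)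
  finally show ?thesis
    using cd by (simp add: emeasure_eq_measure ennreal_mult'[symmetric])
qed

section \<open>Full cylinders carry a positive proportion of the mass\<close>

definition full_part :: "real \<Rightarrow> nat \<Rightarrow> real set" where
  "full_part \<alpha> n = (\<Union>u\<in>{u. full \<alpha> u \<and> length u = n}. cylinder \<alpha> u)"

text \<open>The countable part pulls 0 and the left endpoint back along all branches. Outside the
  whole set every orbit stays in the open interval and avoids 0, so cylinders of every order contain
  the point.\<close>

definition exceptional :: "real \<Rightarrow> real set" where
  "exceptional \<alpha> = - Kin \<alpha> \<union> (\<Union>w. {branch w 0, branch w (- \<alpha>)})"

text \<open>For k at most n, the points that are in B at time n and whose first n digits have their
  longest full prefix of length n - k.\<close>

definition bad_part :: "real \<Rightarrow> nat \<Rightarrow> nat \<Rightarrow> real set \<Rightarrow> real set" where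
  "bad_part \<alpha> n k B = (\<Union>v\<in>bad \<alpha> k. full_part \<alpha> (n - k) \<inter> (tau \<alpha> ^^ (n - k)) -` (cylinder \<alpha> v \<inter> (tau \<alpha> ^^ k) -` B))"

text \<open>\<open>exp 24\<close> is the square of the distortion constant \<open>exp 12\<close> of \<open>(jac w y)\<^sup>2\<close>.\<close>

definition bad_weight :: "real \<Rightarrow> nat \<Rightarrow> real" where
  "bad_weight \<alpha> k = exp 24 * real (card (bad \<alpha> k)) * (3 * contraction \<alpha> ^ k)"

lemma full_part_borel [measurable, simp]: "full_part \<alpha> n \<in> sets borel"
  unfolding full_part_def by (intro sets.countable_UN') auto

lemma exceptional_null: "exceptional \<alpha> \<in> sets borel" "measure (unif_Kin \<alpha>) (exceptional \<alpha>) = 0"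
proof -
  let ?Z = "\<Union>w. {branch w 0, branch w (- \<alpha>)}"
  have c: "countable ?Z" by (intro countable_UN) auto
  have Z: "?Z \<in> sets borel" using c by (rule sets.countable[rotated]) auto
  have "emeasure (unif_Kin \<alpha>) ?Z \<le> emeasure lborel ?Z"
    using Z by (subst emeasure_unif_Kin) (auto intro!: emeasure_mono)
  also have "\<dots> = 0" using emeasure_lborel_countable[OF c] .
  finally have "?Z \<in> null_sets (unif_Kin \<alpha>)" using Z by auto
  moreover have "- Kin \<alpha> \<in> null_sets (unif_Kin \<alpha>)"
    by (auto intro!: null_setsI simp: emeasure_unif_Kin)
  ultimately have "exceptional \<alpha> \<in> null_sets (unif_Kin \<alpha>)" unfolding exceptional_def by (rule null_sets.Un[rotated])
  thus "exceptional \<alpha> \<in> sets borel" "measure (unif_Kin \<alpha>) (exceptional \<alpha>) = 0"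
    by (auto simp: null_sets_def measure_def)
qed

lemma cylinder_exists:
  assumes "x \<notin> exceptional \<alpha>"
  shows "\<exists>w. length w = n \<and> x \<in> cylinder \<alpha> w"
proof -
  have "\<exists>w y. length w = n \<and> y \<in> tails \<alpha> w \<and> branch w y = x"
  proof (induction n)
    case 0
    thus ?case using assms by (auto simp: exceptional_def)
  next
    case (Suc n)
    then obtain w y where w: "length w = n" "y \<in> tails \<alpha> w" "branch w y = x" by auto
    have "y \<noteq> 0" using w assms by (auto simp: exceptional_def)
    define a where "a = \<lfloor>1 / y + \<alpha>\<rfloor>"
    have y': "1 / (of_int a + tau \<alpha> y) = y" "of_int a + tau \<alpha> y \<noteq> 0"
      using \<open>y \<noteq> 0\<close> by (auto simp: a_def tau_def)
    have x: "branch (w @ [a]) (tau \<alpha> y) = x" using w y' by (simp add: branch_append)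
    have "x \<noteq> branch v (- \<alpha>)" for v using assms by (auto simp: exceptional_def)
    hence "tau \<alpha> y \<noteq> - \<alpha>" using x by metis
    hence "tau \<alpha> y \<in> Kin \<alpha>" using tau_range[of \<alpha> y] by (auto simp: Kin_def)
    hence "tau \<alpha> y \<in> tails \<alpha> (w @ [a])"
      using y' w tails_subset[of \<alpha> w] by (auto simp: tails_append)
    thus ?case using x w by (intro exI[of _ "w @ [a]"] exI[of _ "tau \<alpha> y"]) auto
  qed
  thus ?thesis by (auto simp: cylinder_conv)
qed

text \<open>Cut at the largest full prefix. A nonempty full prefix of the remainder could be
  appended to it, giving a longer full prefix.\<close>

lemma last_full_prefix:
  assumes "x \<in> cylinder \<alpha> w"
  obtains u v where "w = u @ v" "full \<alpha> u" "v \<in> bad \<alpha> (length v)"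
proof -
  define j where "j = Max {j. j \<le> length w \<and> full \<alpha> (take j w)}"
  have fin: "finite {j. j \<le> length w \<and> full \<alpha> (take j w)}" by auto
  have "0 \<in> {j. j \<le> length w \<and> full \<alpha> (take j w)}" by (auto simp: full_def)
  hence "j \<in> {j. j \<le> length w \<and> full \<alpha> (take j w)}" unfolding j_def using fin by (intro Max_in) auto
  hence j: "j \<le> length w" "full \<alpha> (take j w)" by auto
  have "tails \<alpha> (drop j w) = tails \<alpha> w" using tails_full_append[OF j(2), of "drop j w"] by simp
  hence ne: "tails \<alpha> (drop j w) \<noteq> {}" using assms by (auto simp: cylinder_conv)
  have "\<not> full \<alpha> (take i (drop j w))" if "i \<in> {1..length w - j}" for i
  proof
    assume "full \<alpha> (take i (drop j w))"
    hence "full \<alpha> (take (j + i) w)"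
      using tails_full_append[OF j(2), of "take i (drop j w)"] by (simp add: take_add full_def)
    hence "j + i \<in> {j. j \<le> length w \<and> full \<alpha> (take j w)}" using that j by auto
    hence "j + i \<le> j" unfolding j_def using fin Max_ge by blast
    thus False using that by auto
  qed
  hence "drop j w \<in> bad \<alpha> (length (drop j w))" using ne by (auto simp: bad_def)
  thus thesis using that[of "take j w" "drop j w"] j by auto
qed

lemma exceptional_decomp:
  assumes "x \<notin> exceptional \<alpha>" "(tau \<alpha> ^^ n) x \<in> B"
  shows "\<exists>k\<le>n. x \<in> bad_part \<alpha> n k B"
proof -
  obtain w where w: "length w = n" "x \<in> cylinder \<alpha> w" using cylinder_exists[OF assms(1)] by blast
  then obtain u v where uv: "w = u @ v" "full \<alpha> u" "v \<in> bad \<alpha> (length v)"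
    using last_full_prefix by blast
  have x: "x \<in> cylinder \<alpha> u" "(tau \<alpha> ^^ length u) x \<in> cylinder \<alpha> v" using w uv by (auto simp: cylinder_append)
  have n: "length v \<le> n" "length u = n - length v" using w uv by auto
  have "(tau \<alpha> ^^ length v) ((tau \<alpha> ^^ length u) x) = (tau \<alpha> ^^ n) x"
    using n by (metis funpow_add o_apply le_add_diff_inverse)
  hence "x \<in> bad_part \<alpha> n (length v) B"
    unfolding bad_part_def full_part_def using x uv n assms(2) by auto
  thus ?thesis using n by blast
qed

section \<open>Counting bad words\<close>

context
  fixes \<alpha> :: real
  assumes \<alpha>: "\<alpha> \<in> {0..1}"
begin

text \<open>By \<open>nonfull_child\<close> a bad word extends to a bad word in at most two ways;
  the Boolean selects the endpoint of the tails that determines the digit. Hence the number of bad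
  words at most doubles.\<close>

lemma bad_Suc_subset:
  "bad \<alpha> (Suc k) \<subseteq> (\<lambda>(v, b). v @ [\<lfloor>1 / (if b then Inf (tails \<alpha> v) else Sup (tails \<alpha> v)) + \<alpha>\<rfloor>]) ` (bad \<alpha> k \<times> UNIV)"
    (is "_ \<subseteq> ?f ` _")
proof
  fix v' assume v': "v' \<in> bad \<alpha> (Suc k)"
  then obtain v a where va: "v' = v @ [a]" "length v = k"
    by (cases v' rule: rev_cases) (auto simp: bad_def)
  have ne: "tails \<alpha> (v @ [a]) \<noteq> {}" using v' va by (auto simp: bad_def)
  have nf: "\<not> full \<alpha> (take j (v @ [a]))" if "j \<in> {1..Suc k}" for j
    using v' va that by (auto simp: bad_def)
  have "tails \<alpha> v \<noteq> {}" using ne tails_snoc[OF \<alpha>] by blast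
  moreover have "\<not> full \<alpha> (take j v)" if "j \<in> {1..k}" for j
    using nf[of j] that va by auto
  ultimately have v: "v \<in> bad \<alpha> k" using va by (auto simp: bad_def)
  have "\<not> full \<alpha> (v @ [a])" using nf[of "Suc k"] va by simp
  hence "a \<in> {\<lfloor>1 / Inf (tails \<alpha> v) + \<alpha>\<rfloor>, \<lfloor>1 / Sup (tails \<alpha> v) + \<alpha>\<rfloor>}"
    using nonfull_child[OF \<alpha>] ne by blast
  hence "v' = ?f (v, True) \<or> v' = ?f (v, False)" using va by auto
  thus "v' \<in> ?f ` (bad \<alpha> k \<times> UNIV)" using v by blast
qed

lemma card_bad: "finite (bad \<alpha> k) \<and> card (bad \<alpha> k) \<le> 2 ^ k"
proof (induction k)
  case 0
  have "bad \<alpha> 0 \<subseteq> {[]}" by (auto simp: bad_def)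
  thus ?case using card_mono[of "{[]}" "bad \<alpha> 0"] finite_subset by auto
next
  case (Suc k)
  have fin: "finite (bad \<alpha> k \<times> (UNIV :: bool set))" using Suc by auto
  have "card (bad \<alpha> (Suc k)) \<le> card (bad \<alpha> k \<times> (UNIV :: bool set))"
    using bad_Suc_subset fin by (rule surj_card_le[rotated])
  also have "\<dots> \<le> 2 ^ Suc k" using Suc by (simp add: card_cartesian_product)
  finally show ?case using finite_subset[OF bad_Suc_subset] fin by auto
qed

text \<open>Here the map is the Gauss map or its mirror image, and every branch is onto. The case
  needs its own treatment because \<open>contraction \<alpha>\<close> equals 1/2, which only
  balances the growth \<open>2 ^ k\<close>.\<close>

lemma bad_empty:
  assumes "\<alpha> = 0 \<or> \<alpha> = 1"
  shows "bad \<alpha> (Suc k) = {}"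
proof (rule ccontr)
  assume "bad \<alpha> (Suc k) \<noteq> {}"
  then obtain v where v: "length v = Suc k" "tails \<alpha> v \<noteq> {}" "\<not> full \<alpha> (take 1 v)"
    unfolding bad_def by fastforce
  then obtain a v' where a: "v = [a] @ v'" by (cases v) auto
  obtain y where "y \<in> tails \<alpha> [a]" using v(2) tails_append[of _ \<alpha> "[a]" v'] unfolding a by blast
  hence y: "y \<in> Kin \<alpha>" "of_int a + y \<noteq> 0" "1 / (of_int a + y) \<in> Kin \<alpha>" by auto
  have "z \<in> tails \<alpha> [a]" if z: "z \<in> Kin \<alpha>" for z
    using assms
  proof
    assume 0: "\<alpha> = 0"
    have "of_int a + y > 0" using y 0 by (auto simp: Kin_def)
    hence "of_int a + y > 1" using y 0 by (auto simp: Kin_def divide_simps)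
    hence "a \<ge> 1" using y 0 by (auto simp: Kin_def)
    hence "of_int a \<ge> (1::real)" by simp
    hence "of_int a + z > 1" using z 0 by (auto simp: Kin_def)
    thus ?thesis using z 0 by (auto simp: Kin_def divide_simps)
  next
    assume 1: "\<alpha> = 1"
    have "of_int a + y < 0" using y 1 by (auto simp: Kin_def)
    hence "of_int a + y < -1" using y 1 by (auto simp: Kin_def divide_simps)
    hence "a \<le> -1" using y 1 by (auto simp: Kin_def)
    hence "of_int a \<le> (-1::real)" by linarith
    hence "of_int a + z < -1" using z 1 by (auto simp: Kin_def)
    thus ?thesis using z 1 by (auto simp: Kin_def divide_simps)
  qed
  hence "full \<alpha> [a]" unfolding full_def using tails_subset by blast
  thus False using v a by simp
qed

lemma bad_weight_nonneg: "bad_weight \<alpha> k \<ge> 0"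
  using contraction_bounds[OF \<alpha>] by (simp add: bad_weight_def)

lemma summable_bad_weight: "summable (bad_weight \<alpha>)"
proof (cases "\<alpha> = 0 \<or> \<alpha> = 1")
  case True
  have "bad_weight \<alpha> k = 0" if "k \<notin> {0}" for k
    using bad_empty[OF True] that by (cases k) (auto simp: bad_weight_def)
  thus ?thesis by (intro summable_finite[of "{0}"]) auto
next
  case False
  have c: "contraction \<alpha> \<ge> 1 / 3" "contraction \<alpha> < 1 / 2" using contraction_bounds[OF \<alpha>] False \<alpha> by auto
  have "bad_weight \<alpha> k \<le> exp 24 * 3 * (2 * contraction \<alpha>) ^ k" for k
  proof -
    have "real (card (bad \<alpha> k)) \<le> 2 ^ k" using card_bad[of k] by (metis of_nat_le_iff of_nat_numeral of_nat_power)
    hence "bad_weight \<alpha> k \<le> exp 24 * 2 ^ k * (3 * contraction \<alpha> ^ k)"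
      unfolding bad_weight_def using c by (intro mult_right_mono mult_left_mono) auto
    thus ?thesis by (simp add: power_mult_distrib mult_ac)
  qed
  moreover have "summable (\<lambda>k. exp 24 * 3 * (2 * contraction \<alpha>) ^ k)"
    using c by (intro summable_mult summable_geometric) auto
  ultimately show ?thesis using bad_weight_nonneg
    by (intro summable_comparison_test'[of "\<lambda>k. exp 24 * 3 * (2 * contraction \<alpha>) ^ k" 0 "bad_weight \<alpha>"]) simp_all
qed

section \<open>Estimates on full cylinders and on preimages\<close>

lemma Kin_mid: "1 / 2 - \<alpha> \<in> Kin \<alpha>"
  by (auto simp: Kin_def)

text \<open>Let c be the derivative modulus of the branch at the midpoint. By distortion the measure
  of the preimage of B in the cylinder is c times the measure of B, up to a factor
  \<open>exp 12\<close>. Taking B to be the whole line compares c with the measure of the cylinder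
  at the cost of a second such factor.\<close>

lemma full_cylinder_bounds:
  assumes u: "full \<alpha> u" and B: "B \<in> sets borel"
  shows "measure (unif_Kin \<alpha>) (cylinder \<alpha> u \<inter> (tau \<alpha> ^^ length u) -` B)
           \<le> exp 24 * (measure (unif_Kin \<alpha>) (cylinder \<alpha> u) * measure (unif_Kin \<alpha>) B)"
    and "measure (unif_Kin \<alpha>) (cylinder \<alpha> u) * measure (unif_Kin \<alpha>) B
           \<le> exp 24 * measure (unif_Kin \<alpha>) (cylinder \<alpha> u \<inter> (tau \<alpha> ^^ length u) -` B)"
    and "measure (unif_Kin \<alpha>) (cylinder \<alpha> u) > 0"
proof -
  define c where "c = (jac u (1 / 2 - \<alpha>))\<^sup>2"
  have V: "tails \<alpha> u = Kin \<alpha>" using u by (simp add: full_def)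
  have y0: "1 / 2 - \<alpha> \<in> tails \<alpha> u" using V Kin_mid by simp
  have c0: "c > 0" using jac_pos[OF \<alpha> y0] by (simp add: c_def)
  have e: "(exp 6)\<^sup>2 = exp (12::real)" "exp 12 * exp 12 = exp (24::real)" "exp 12 \<ge> (1::real)"
    by (simp_all add: exp_double[symmetric] exp_add[symmetric])
  have up: "(jac u y)\<^sup>2 \<le> exp 12 * c" if "y \<in> tails \<alpha> u" for y
    using power_mono[OF jac_distortion[OF \<alpha> that y0], of 2] jac_pos[OF \<alpha> that] e
    by (simp add: power_mult_distrib c_def)
  have lo: "c / exp 12 \<le> (jac u y)\<^sup>2" if "y \<in> tails \<alpha> u" for y
    using power_mono[OF jac_distortion[OF \<alpha> y0 that], of 2] jac_pos[OF \<alpha> y0] e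
    by (simp add: power_mult_distrib c_def field_simps)
  have m: "measure lborel (A \<inter> tails \<alpha> u) = measure (unif_Kin \<alpha>) A" if "A \<in> sets borel" for A
    using that by (simp add: V measure_unif_Kin Int_commute)
  have up': "measure (unif_Kin \<alpha>) (cylinder \<alpha> u \<inter> (tau \<alpha> ^^ length u) -` A) \<le> exp 12 * c * measure (unif_Kin \<alpha>) A"
    and lo': "c / exp 12 * measure (unif_Kin \<alpha>) A \<le> measure (unif_Kin \<alpha>) (cylinder \<alpha> u \<inter> (tau \<alpha> ^^ length u) -` A)"
    if A: "A \<in> sets borel" for A
    unfolding measure_cylinder_vimage[OF A] m[OF A, symmetric]
    by (rule branch_image_measure_le branch_image_measure_ge; use A up lo in auto)+
  have one: "measure (unif_Kin \<alpha>) UNIV = 1" using unif_Kin.prob_space[of \<alpha>] by simp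
  have C: "measure (unif_Kin \<alpha>) (cylinder \<alpha> u) \<le> exp 12 * c" "c / exp 12 \<le> measure (unif_Kin \<alpha>) (cylinder \<alpha> u)"
    using up'[of UNIV] lo'[of UNIV] one by auto
  show "measure (unif_Kin \<alpha>) (cylinder \<alpha> u) > 0" using C(2) c0 by (meson divide_pos_pos exp_gt_zero less_le_trans)
  have "exp 12 * c \<le> exp 24 * measure (unif_Kin \<alpha>) (cylinder \<alpha> u)"
    unfolding e(2)[symmetric] using mult_left_mono[OF C(2), of "exp 12 * exp 12"] by simp
  hence "exp 12 * c * measure (unif_Kin \<alpha>) B \<le> exp 24 * measure (unif_Kin \<alpha>) (cylinder \<alpha> u) * measure (unif_Kin \<alpha>) B"
    by (intro mult_right_mono) auto
  thus "measure (unif_Kin \<alpha>) (cylinder \<alpha> u \<inter> (tau \<alpha> ^^ length u) -` B)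
           \<le> exp 24 * (measure (unif_Kin \<alpha>) (cylinder \<alpha> u) * measure (unif_Kin \<alpha>) B)"
    using up'[OF B] by (simp add: mult_ac)
  have "measure (unif_Kin \<alpha>) (cylinder \<alpha> u) * measure (unif_Kin \<alpha>) B \<le> exp 12 * c * measure (unif_Kin \<alpha>) B"
    using C(1) by (intro mult_right_mono) auto
  also have "\<dots> = exp 24 * (c / exp 12 * measure (unif_Kin \<alpha>) B)"
    by (simp add: e(2)[symmetric])
  also have "\<dots> \<le> exp 24 * measure (unif_Kin \<alpha>) (cylinder \<alpha> u \<inter> (tau \<alpha> ^^ length u) -` B)"
    using lo'[OF B] by (intro mult_left_mono) auto
  finally show "measure (unif_Kin \<alpha>) (cylinder \<alpha> u) * measure (unif_Kin \<alpha>) B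
           \<le> exp 24 * measure (unif_Kin \<alpha>) (cylinder \<alpha> u \<inter> (tau \<alpha> ^^ length u) -` B)" .
qed

text \<open>Only the uniform contraction enters, not fullness, so the estimate is available for bad
  words.\<close>

lemma cylinder_vimage_le:
  assumes B: "B \<in> sets borel"
  shows "measure (unif_Kin \<alpha>) (cylinder \<alpha> v \<inter> (tau \<alpha> ^^ length v) -` B) \<le> 3 * contraction \<alpha> ^ length v * measure (unif_Kin \<alpha>) B"
proof -
  have "measure (unif_Kin \<alpha>) (cylinder \<alpha> v \<inter> (tau \<alpha> ^^ length v) -` B)
      \<le> 3 * contraction \<alpha> ^ length v * measure lborel (B \<inter> tails \<alpha> v)"
    unfolding measure_cylinder_vimage[OF B]
    using jac_sq_le[OF \<alpha>] B by (intro branch_image_measure_le) auto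
  also have "\<dots> \<le> 3 * contraction \<alpha> ^ length v * measure (unif_Kin \<alpha>) B"
    using measure_unif_Kin_Int_tails[OF B] contraction_bounds[OF \<alpha>] by (intro mult_left_mono) auto
  finally show ?thesis .
qed

lemma full_part_disjoint: "disjoint_family_on (cylinder \<alpha>) {u. full \<alpha> u \<and> length u = n}"
  unfolding disjoint_family_on_def by (auto intro!: cylinder_disjoint)

lemma full_part_vimage_le:
  assumes B: "B \<in> sets borel"
  shows "measure (unif_Kin \<alpha>) (full_part \<alpha> n \<inter> (tau \<alpha> ^^ n) -` B) \<le> exp 24 * measure (unif_Kin \<alpha>) B * measure (unif_Kin \<alpha>) (full_part \<alpha> n)"
  unfolding full_part_def
proof (rule unif_Kin.measure_UN_mono')
  fix u assume "u \<in> {u. full \<alpha> u \<and> length u = n}"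
  thus "measure (unif_Kin \<alpha>) (cylinder \<alpha> u \<inter> (tau \<alpha> ^^ n) -` B) \<le> exp 24 * measure (unif_Kin \<alpha>) B * measure (unif_Kin \<alpha>) (cylinder \<alpha> u)"
    using full_cylinder_bounds(1)[of u B] B by (auto simp: mult_ac)
qed (use B full_part_disjoint in auto)

lemma full_part_vimage_ge:
  assumes B: "B \<in> sets borel"
  shows "measure (unif_Kin \<alpha>) B * measure (unif_Kin \<alpha>) (full_part \<alpha> n) \<le> exp 24 * measure (unif_Kin \<alpha>) (full_part \<alpha> n \<inter> (tau \<alpha> ^^ n) -` B)"
  unfolding full_part_def
proof (rule unif_Kin.measure_UN_mono)
  fix u assume "u \<in> {u. full \<alpha> u \<and> length u = n}"
  thus "measure (unif_Kin \<alpha>) B * measure (unif_Kin \<alpha>) (cylinder \<alpha> u) \<le> exp 24 * measure (unif_Kin \<alpha>) (cylinder \<alpha> u \<inter> (tau \<alpha> ^^ n) -` B)"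
    using full_cylinder_bounds(2)[of u B] B by (auto simp: mult_ac)
qed (use B full_part_disjoint in auto)

lemma bad_part_borel: "B \<in> sets borel \<Longrightarrow> bad_part \<alpha> n k B \<in> sets borel"
  unfolding bad_part_def using card_bad by (intro sets.finite_UN sets.Int vimage_tau_pow) simp_all

text \<open>The full prefix is handled by distortion, with the preimage of B in the cylinder of the
  bad word as target; that target is then bounded by contraction, and the number of bad words
  completes the weight.\<close>

lemma bad_part_le:
  assumes B: "B \<in> sets borel"
  shows "measure (unif_Kin \<alpha>) (bad_part \<alpha> n k B) \<le> bad_weight \<alpha> k * measure (unif_Kin \<alpha>) (full_part \<alpha> (n - k)) * measure (unif_Kin \<alpha>) B"
proof -
  have "measure (unif_Kin \<alpha>) (bad_part \<alpha> n k B)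
      \<le> (\<Sum>v\<in>bad \<alpha> k. measure (unif_Kin \<alpha>) (full_part \<alpha> (n - k) \<inter> (tau \<alpha> ^^ (n - k)) -` (cylinder \<alpha> v \<inter> (tau \<alpha> ^^ k) -` B)))"
    unfolding bad_part_def using B card_bad by (intro unif_Kin.finite_measure_subadditive_finite) auto
  also have "\<dots> \<le> (\<Sum>v\<in>bad \<alpha> k. exp 24 * (3 * contraction \<alpha> ^ k * measure (unif_Kin \<alpha>) B) * measure (unif_Kin \<alpha>) (full_part \<alpha> (n - k)))"
  proof (rule sum_mono)
    fix v assume "v \<in> bad \<alpha> k"
    hence v: "length v = k" by (simp add: bad_def)
    have "measure (unif_Kin \<alpha>) (full_part \<alpha> (n - k) \<inter> (tau \<alpha> ^^ (n - k)) -` (cylinder \<alpha> v \<inter> (tau \<alpha> ^^ k) -` B))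
        \<le> exp 24 * measure (unif_Kin \<alpha>) (cylinder \<alpha> v \<inter> (tau \<alpha> ^^ k) -` B) * measure (unif_Kin \<alpha>) (full_part \<alpha> (n - k))"
      using B by (intro full_part_vimage_le) auto
    also have "\<dots> \<le> exp 24 * (3 * contraction \<alpha> ^ k * measure (unif_Kin \<alpha>) B) * measure (unif_Kin \<alpha>) (full_part \<alpha> (n - k))"
      using cylinder_vimage_le[OF B, of v] v by (intro mult_right_mono mult_left_mono) auto
    finally show "measure (unif_Kin \<alpha>) (full_part \<alpha> (n - k) \<inter> (tau \<alpha> ^^ (n - k)) -` (cylinder \<alpha> v \<inter> (tau \<alpha> ^^ k) -` B))
        \<le> exp 24 * (3 * contraction \<alpha> ^ k * measure (unif_Kin \<alpha>) B) * measure (unif_Kin \<alpha>) (full_part \<alpha> (n - k))" .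
  qed
  also have "\<dots> = bad_weight \<alpha> k * measure (unif_Kin \<alpha>) (full_part \<alpha> (n - k)) * measure (unif_Kin \<alpha>) B"
    by (simp add: bad_weight_def mult_ac)
  finally show ?thesis .
qed

text \<open>The masses of the full parts are kept in the sum: bounding them by 1 gives
  \<open>vimage_le\<close>, while taking B to be everything gives a renewal inequality that bounds
  these masses from below.\<close>

lemma vimage_le_sum:
  assumes B: "B \<in> sets borel"
  shows "measure (unif_Kin \<alpha>) ((tau \<alpha> ^^ n) -` B)
           \<le> (\<Sum>k\<le>n. bad_weight \<alpha> k * measure (unif_Kin \<alpha>) (full_part \<alpha> (n - k))) * measure (unif_Kin \<alpha>) B"
proof -
  have "(tau \<alpha> ^^ n) -` B \<subseteq> exceptional \<alpha> \<union> (\<Union>k\<le>n. bad_part \<alpha> n k B)"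
    using exceptional_decomp by fastforce
  hence "measure (unif_Kin \<alpha>) ((tau \<alpha> ^^ n) -` B) \<le> measure (unif_Kin \<alpha>) (exceptional \<alpha> \<union> (\<Union>k\<le>n. bad_part \<alpha> n k B))"
    using bad_part_borel[OF B] exceptional_null by (intro unif_Kin.finite_measure_mono) auto
  also have "\<dots> \<le> measure (unif_Kin \<alpha>) (exceptional \<alpha>) + measure (unif_Kin \<alpha>) (\<Union>k\<le>n. bad_part \<alpha> n k B)"
    using bad_part_borel[OF B] exceptional_null by (intro measure_Un_le) auto
  also have "\<dots> \<le> (\<Sum>k\<le>n. measure (unif_Kin \<alpha>) (bad_part \<alpha> n k B))"
    unfolding exceptional_null using bad_part_borel[OF B] by (simp, intro unif_Kin.finite_measure_subadditive_finite) auto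
  also have "\<dots> \<le> (\<Sum>k\<le>n. bad_weight \<alpha> k * measure (unif_Kin \<alpha>) (full_part \<alpha> (n - k)) * measure (unif_Kin \<alpha>) B)"
    using bad_part_le[OF B] by (intro sum_mono)
  finally show ?thesis by (simp add: sum_distrib_right)
qed

lemma vimage_le:
  assumes B: "B \<in> sets borel"
  shows "measure (unif_Kin \<alpha>) ((tau \<alpha> ^^ n) -` B) \<le> suminf (bad_weight \<alpha>) * measure (unif_Kin \<alpha>) B"
proof -
  have "(\<Sum>k\<le>n. bad_weight \<alpha> k * measure (unif_Kin \<alpha>) (full_part \<alpha> (n - k))) \<le> (\<Sum>k\<le>n. bad_weight \<alpha> k * 1)"
    using bad_weight_nonneg by (intro sum_mono mult_left_mono) auto
  also have "\<dots> \<le> suminf (bad_weight \<alpha>)"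
    using sum_le_suminf[OF summable_bad_weight, of "{..n}"] bad_weight_nonneg by simp
  finally show ?thesis
    using vimage_le_sum[OF B, of n] by (meson measure_nonneg mult_right_mono order_trans)
qed

text \<open>A large positive digit works, since its branch maps into the positive part of the
  interval. For \<alpha> = 1 there is no positive part, and -2 serves instead.\<close>

lemma exists_full_digit: "\<exists>a. full \<alpha> [a]"
proof (cases "\<alpha> = 1")
  case True
  have "z \<in> tails \<alpha> [-2]" if z: "z \<in> Kin \<alpha>" for z
    using z True by (auto simp: Kin_def divide_simps)
  thus ?thesis unfolding full_def using tails_subset by blast
next
  case False
  define a where "a = \<lceil>1 / (1 - \<alpha>)\<rceil> + 1"
  have a: "of_int a \<ge> 1 / (1 - \<alpha>) + 1" unfolding a_def by simp
  have "z \<in> tails \<alpha> [a]" if z: "z \<in> Kin \<alpha>" for z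
  proof -
    have *: "of_int a + z > 1 / (1 - \<alpha>)" "1 / (1 - \<alpha>) > 0" using a z \<alpha> False by (auto simp: Kin_def)
    hence p: "of_int a + z > 0" by linarith
    have "1 / (of_int a + z) < 1 / (1 / (1 - \<alpha>))"
      using * p by (intro divide_strict_left_mono mult_pos_pos) simp_all
    hence "1 / (of_int a + z) < 1 - \<alpha>" by simp
    moreover have "- \<alpha> < 1 / (of_int a + z)" using p \<alpha>
      by (metis atLeastAtMost_iff divide_pos_pos le_less_trans neg_le_0_iff_le zero_less_one)
    ultimately show ?thesis using z p by (auto simp: Kin_def)
  qed
  thus ?thesis unfolding full_def using tails_subset by blast
qed

text \<open>Appending one fixed full digit to full words gives full words. By itself this only
  prevents faster than exponential decay of the masses.\<close>

lemma full_part_mass_step: "\<exists>\<delta>>0. \<delta> \<le> 1 \<and> (\<forall>n. \<delta> * measure (unif_Kin \<alpha>) (full_part \<alpha> n) \<le> measure (unif_Kin \<alpha>) (full_part \<alpha> (Suc n)))"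
proof -
  obtain a where a: "full \<alpha> [a]" using exists_full_digit by blast
  define \<delta> where "\<delta> = measure (unif_Kin \<alpha>) (cylinder \<alpha> [a]) / exp 24"
  have p: "measure (unif_Kin \<alpha>) (cylinder \<alpha> [a]) > 0" "measure (unif_Kin \<alpha>) (cylinder \<alpha> [a]) \<le> 1"
    using full_cylinder_bounds(3)[OF a] by auto
  have "\<delta> > 0" using p by (simp add: \<delta>_def)
  moreover have "\<delta> \<le> 1"
  proof -
    have "(1::real) \<le> exp 24" by simp
    hence "measure (unif_Kin \<alpha>) (cylinder \<alpha> [a]) \<le> exp 24" using p by linarith
    thus ?thesis by (simp add: \<delta>_def)
  qed
  moreover have "\<delta> * measure (unif_Kin \<alpha>) (full_part \<alpha> n) \<le> measure (unif_Kin \<alpha>) (full_part \<alpha> (Suc n))" for n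
  proof -
    have "full_part \<alpha> n \<inter> (tau \<alpha> ^^ n) -` cylinder \<alpha> [a] \<subseteq> full_part \<alpha> (Suc n)"
    proof
      fix x assume "x \<in> full_part \<alpha> n \<inter> (tau \<alpha> ^^ n) -` cylinder \<alpha> [a]"
      then obtain u where u: "full \<alpha> u" "length u = n" "x \<in> cylinder \<alpha> (u @ [a])"
        unfolding full_part_def by (auto simp: cylinder_append)
      moreover have "full \<alpha> (u @ [a])" using tails_full_append[OF u(1)] a by (simp add: full_def del: tails.simps)
      ultimately show "x \<in> full_part \<alpha> (Suc n)" unfolding full_part_def by force
    qed
    hence "measure (unif_Kin \<alpha>) (full_part \<alpha> n \<inter> (tau \<alpha> ^^ n) -` cylinder \<alpha> [a]) \<le> measure (unif_Kin \<alpha>) (full_part \<alpha> (Suc n))"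
      by (intro unif_Kin.finite_measure_mono) auto
    hence "exp 24 * measure (unif_Kin \<alpha>) (full_part \<alpha> n \<inter> (tau \<alpha> ^^ n) -` cylinder \<alpha> [a]) \<le> exp 24 * measure (unif_Kin \<alpha>) (full_part \<alpha> (Suc n))"
      by (intro mult_left_mono) auto
    hence "measure (unif_Kin \<alpha>) (cylinder \<alpha> [a]) * measure (unif_Kin \<alpha>) (full_part \<alpha> n) \<le> exp 24 * measure (unif_Kin \<alpha>) (full_part \<alpha> (Suc n))"
      by (rule order_trans[OF full_part_vimage_ge[OF cylinder_borel]])
    thus ?thesis unfolding \<delta>_def by (simp add: divide_le_eq mult.commute)
  qed
  ultimately show ?thesis by blast
qed

lemma bad_weight_tail:
  assumes "\<epsilon> > 0"
  obtains k0 where "\<And>n. (\<Sum>k\<in>{k0..n}. bad_weight \<alpha> k) \<le> \<epsilon>"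
proof -
  obtain k0 where k0: "\<forall>m\<ge>k0. \<forall>n. norm (sum (bad_weight \<alpha>) {m..<n}) < \<epsilon>"
    using summable_bad_weight assms unfolding summable_Cauchy by blast
  have "(\<Sum>k\<in>{k0..n}. bad_weight \<alpha> k) \<le> \<epsilon>" for n
  proof -
    have "norm (sum (bad_weight \<alpha>) {k0..<Suc n}) < \<epsilon>" using k0 by blast
    thus ?thesis by (simp add: atLeastLessThanSuc_atLeastAtMost)
  qed
  thus thesis using that by blast
qed

text \<open>A renewal argument. In \<open>vimage_le_sum\<close> for the whole line, the terms with k
  at least k0 contribute at most 1/2. In the others the mass at order n - k is at most
  \<open>\<delta> ^ k0\<close> times smaller in the divisor, that is, at most the mass at order n
  divided by \<open>\<delta> ^ k0\<close>. So the mass at order n cannot be small.\<close>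

lemma full_part_mass: "\<exists>c>0. \<forall>n. c \<le> measure (unif_Kin \<alpha>) (full_part \<alpha> n)"
proof -
  obtain \<delta> where \<delta>: "\<delta> > 0" "\<delta> \<le> 1"
    "\<And>n. \<delta> * measure (unif_Kin \<alpha>) (full_part \<alpha> n) \<le> measure (unif_Kin \<alpha>) (full_part \<alpha> (Suc n))"
    using full_part_mass_step by blast
  let ?m = "\<lambda>n. measure (unif_Kin \<alpha>) (full_part \<alpha> n)"
  have step: "\<delta> ^ k * ?m n \<le> ?m (n + k)" for k n
  proof (induction k)
    case (Suc k)
    have "\<delta> ^ Suc k * ?m n = \<delta> * (\<delta> ^ k * ?m n)" by simp
    also have "\<dots> \<le> \<delta> * ?m (n + k)" using Suc \<delta> by (intro mult_left_mono) auto
    also have "\<dots> \<le> ?m (n + Suc k)" using \<delta>(3) by simp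
    finally show ?case .
  qed simp
  obtain k0 where k0: "\<And>n. (\<Sum>k\<in>{k0..n}. bad_weight \<alpha> k) \<le> 1 / 2" using bad_weight_tail[of "1 / 2"] by auto
  \<comment> \<open>The added 1 makes \<open>?S\<close> positive, so that it can be divided
    by.\<close>
  let ?S = "suminf (bad_weight \<alpha>) + 1"
  have S: "?S > 0" using suminf_nonneg[OF summable_bad_weight] bad_weight_nonneg by fastforce
  have "\<delta> ^ k0 / (2 * ?S) \<le> ?m n" for n
  proof -
    have "1 \<le> (\<Sum>k\<le>n. bad_weight \<alpha> k * ?m (n - k))"
      using vimage_le_sum[of UNIV n] unif_Kin.prob_space[of \<alpha>] by simp
    also have "\<dots> \<le> (\<Sum>k\<le>n. (if k0 \<le> k then bad_weight \<alpha> k else 0) + bad_weight \<alpha> k * (?m n / \<delta> ^ k0))"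
    proof (rule sum_mono)
      fix k assume k: "k \<in> {..n}"
      show "bad_weight \<alpha> k * ?m (n - k) \<le> (if k0 \<le> k then bad_weight \<alpha> k else 0) + bad_weight \<alpha> k * (?m n / \<delta> ^ k0)"
      proof (cases "k0 \<le> k")
        case True
        have "bad_weight \<alpha> k * ?m (n - k) \<le> bad_weight \<alpha> k * 1" using bad_weight_nonneg by (intro mult_left_mono) auto
        moreover have "0 \<le> bad_weight \<alpha> k * (?m n / \<delta> ^ k0)" using bad_weight_nonneg \<delta> by auto
        ultimately show ?thesis using True by simp
      next
        case False
        have "\<delta> ^ k0 * ?m (n - k) \<le> \<delta> ^ k * ?m (n - k)"
          using False \<delta> by (intro mult_right_mono power_decreasing) auto
        also have "\<dots> \<le> ?m n" using step[of k "n - k"] k by simp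
        finally have "?m (n - k) \<le> ?m n / \<delta> ^ k0" using \<delta> by (simp add: field_simps)
        hence "bad_weight \<alpha> k * ?m (n - k) \<le> bad_weight \<alpha> k * (?m n / \<delta> ^ k0)"
          using bad_weight_nonneg by (rule mult_left_mono)
        thus ?thesis using False by simp
      qed
    qed
    also have "\<dots> = (\<Sum>k\<le>n. if k0 \<le> k then bad_weight \<alpha> k else 0) + (\<Sum>k\<le>n. bad_weight \<alpha> k) * (?m n / \<delta> ^ k0)"
      by (simp only: sum.distrib sum_distrib_right)
    also have "(\<Sum>k\<le>n. if k0 \<le> k then bad_weight \<alpha> k else 0) = (\<Sum>k\<in>{k0..n}. bad_weight \<alpha> k)"
      by (intro sum.mono_neutral_cong_right) auto
    also have "(\<Sum>k\<in>{k0..n}. bad_weight \<alpha> k) + (\<Sum>k\<le>n. bad_weight \<alpha> k) * (?m n / \<delta> ^ k0) \<le> 1 / 2 + ?S * (?m n / \<delta> ^ k0)"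
      using k0 sum_le_suminf[OF summable_bad_weight, of "{..n}"] bad_weight_nonneg \<delta>
      by (intro add_mono mult_right_mono) auto
    finally have "1 / 2 \<le> ?S * (?m n / \<delta> ^ k0)" by linarith
    also have "?S * (?m n / \<delta> ^ k0) = ?m n * (?S / \<delta> ^ k0)" by simp
    finally have "(1 / 2) / (?S / \<delta> ^ k0) \<le> ?m n" using S \<delta> by (subst divide_le_eq) simp
    thus ?thesis by simp
  qed
  moreover have "\<delta> ^ k0 / (2 * ?S) > 0" using \<delta> S by simp
  ultimately show ?thesis by blast
qed

end

section \<open>Mixing of intervals in dimension one\<close>

lemma measure_unif_Kin_interval_le: "a \<le> b \<Longrightarrow> measure (unif_Kin \<alpha>) {a..b} \<le> b - a"
proof -
  assume "a \<le> b"
  have "measure lborel (Kin \<alpha> \<inter> {a..b}) \<le> measure lborel {a..b}"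
    by (intro measure_mono_fmeasurable) (auto simp: fmeasurable_def emeasure_lborel_Icc_eq)
  thus ?thesis using \<open>a \<le> b\<close> by (simp add: measure_unif_Kin)
qed

context
  fixes \<alpha> :: real
  assumes \<alpha>: "\<alpha> \<in> {0..1}"
begin

text \<open>Run u first, then require the remaining digits to form a full word whose iterate lands
  in B. Each stage costs a factor \<open>exp 24\<close>, and \<open>full_part_mass\<close> keeps the
  second stage bounded below independently of n.\<close>

lemma full_cylinder_mixing:
  "\<exists>c>0. \<forall>u n B. full \<alpha> u \<longrightarrow> length u \<le> n \<longrightarrow> B \<in> sets borel \<longrightarrow>
     c * measure (unif_Kin \<alpha>) B * measure (unif_Kin \<alpha>) (cylinder \<alpha> u) \<le> measure (unif_Kin \<alpha>) (cylinder \<alpha> u \<inter> (tau \<alpha> ^^ n) -` B)"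
proof -
  let ?m = "measure (unif_Kin \<alpha>)"
  obtain c0 where c0: "c0 > 0" "\<And>n. c0 \<le> ?m (full_part \<alpha> n)" using full_part_mass[OF \<alpha>] by blast
  have "c0 / exp 48 * ?m B * ?m (cylinder \<alpha> u) \<le> ?m (cylinder \<alpha> u \<inter> (tau \<alpha> ^^ n) -` B)"
    if u: "full \<alpha> u" "length u \<le> n" and B: "B \<in> sets borel" for u n B
  proof -
    define n' where "n' = n - length u"
    define G where "G = full_part \<alpha> n' \<inter> (tau \<alpha> ^^ n') -` B"
    have G: "G \<in> sets borel" unfolding G_def using B by simp
    have "c0 * ?m B \<le> ?m B * ?m (full_part \<alpha> n')"
      using mult_left_mono[OF c0(2)[of n'], of "?m B"] by (simp add: mult.commute)
    also have "\<dots> \<le> exp 24 * ?m G" unfolding G_def using full_part_vimage_ge[OF \<alpha> B] .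
    finally have "?m (cylinder \<alpha> u) * (c0 * ?m B) \<le> ?m (cylinder \<alpha> u) * (exp 24 * ?m G)"
      by (intro mult_left_mono) auto
    also have "\<dots> = exp 24 * (?m (cylinder \<alpha> u) * ?m G)" by simp
    also have "\<dots> \<le> exp 24 * (exp 24 * ?m (cylinder \<alpha> u \<inter> (tau \<alpha> ^^ length u) -` G))"
      using full_cylinder_bounds(2)[OF \<alpha> u(1) G] by (intro mult_left_mono) auto
    also have "?m (cylinder \<alpha> u \<inter> (tau \<alpha> ^^ length u) -` G) \<le> ?m (cylinder \<alpha> u \<inter> (tau \<alpha> ^^ n) -` B)"
    proof (rule unif_Kin.finite_measure_mono)
      have "(tau \<alpha> ^^ n) x = (tau \<alpha> ^^ n') ((tau \<alpha> ^^ length u) x)" for x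
        using u(2) unfolding n'_def by (metis funpow_add o_apply le_add_diff_inverse2)
      thus "cylinder \<alpha> u \<inter> (tau \<alpha> ^^ length u) -` G \<subseteq> cylinder \<alpha> u \<inter> (tau \<alpha> ^^ n) -` B"
        unfolding G_def by auto
    qed (use B in auto)
    finally have "?m (cylinder \<alpha> u) * (c0 * ?m B) \<le> exp 24 * (exp 24 * ?m (cylinder \<alpha> u \<inter> (tau \<alpha> ^^ n) -` B))"
      by simp
    moreover have "exp 24 * exp 24 = exp (48::real)" by (simp add: exp_add[symmetric])
    ultimately have "?m (cylinder \<alpha> u) * (c0 * ?m B) \<le> ?m (cylinder \<alpha> u \<inter> (tau \<alpha> ^^ n) -` B) * exp 48"
      by (metis mult.assoc mult.commute)
    thus ?thesis by (simp add: divide_le_eq mult_ac)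
  qed
  moreover have "c0 / exp 48 > 0" using c0 by simp
  ultimately show ?thesis by blast
qed

text \<open>Discard a null set, the points within \<epsilon>/8 of either end, and those with at
  least k0 digits after the longest full prefix, of mass at most \<epsilon>/4. Every remaining point
  lies in a full cylinder of diameter at most \<epsilon>/8, hence inside Q, and half of the mass is
  left.\<close>

lemma interval_exhausted:
  fixes a b :: real
  defines "Q \<equiv> {a..b}"
  assumes pos: "measure (unif_Kin \<alpha>) Q > 0"
  shows "\<exists>n. measure (unif_Kin \<alpha>) Q / 2 \<le> measure (unif_Kin \<alpha>) (\<Union>u\<in>{u. full \<alpha> u \<and> length u \<le> n \<and> cylinder \<alpha> u \<subseteq> Q}. cylinder \<alpha> u)"
proof -
  let ?m = "measure (unif_Kin \<alpha>)"
  define \<epsilon> where "\<epsilon> = ?m Q"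
  have \<epsilon>: "\<epsilon> > 0" using pos by (simp add: \<epsilon>_def)
  have "contraction \<alpha> < 1" "0 \<le> contraction \<alpha>" using contraction_bounds[OF \<alpha>] by auto
  then obtain n1 where n1: "contraction \<alpha> ^ n1 < \<epsilon> / 24"
    using real_arch_pow_inv[of "\<epsilon> / 24" "contraction \<alpha>"] \<epsilon> by auto
  obtain k0 where k0: "\<And>n. (\<Sum>k\<in>{k0..n}. bad_weight \<alpha> k) \<le> \<epsilon> / 4" using bad_weight_tail[OF \<alpha>, of "\<epsilon> / 4"] \<epsilon> by auto
  \<comment> \<open>Fewer than k0 digits after the longest full prefix leave that prefix with length
    at least n1, which makes its cylinder short enough.\<close>
  define n where "n = n1 + k0"
  define H where "H = {u. full \<alpha> u \<and> length u \<le> n \<and> cylinder \<alpha> u \<subseteq> Q}"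
  let ?U = "\<Union>u\<in>H. cylinder \<alpha> u" and ?X = "\<Union>k\<in>{k0..n}. bad_part \<alpha> n k UNIV"
  let ?L = "{a..a + \<epsilon> / 8}" and ?R = "{b - \<epsilon> / 8..b}"
  have U: "?U \<in> sets borel" by (intro sets.countable_UN') auto
  have Xb: "?X \<in> sets borel" using bad_part_borel[OF \<alpha>] by (intro sets.finite_UN) auto
  have "Q \<subseteq> exceptional \<alpha> \<union> (?X \<union> (?L \<union> (?R \<union> ?U)))"
  proof
    fix x assume x: "x \<in> Q"
    show "x \<in> exceptional \<alpha> \<union> (?X \<union> (?L \<union> (?R \<union> ?U)))"
    proof (cases "x \<in> exceptional \<alpha> \<or> x \<in> ?X \<or> x \<in> ?L \<or> x \<in> ?R")
      case False
      obtain k where k: "k \<le> n" "x \<in> bad_part \<alpha> n k UNIV"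
        using exceptional_decomp[of x \<alpha> n UNIV] False by auto
      have "k < k0" using k False by (metis UN_I atLeastAtMost_iff not_le)
      obtain u where u: "full \<alpha> u" "length u = n - k" "x \<in> cylinder \<alpha> u"
        using k(2) unfolding bad_part_def full_part_def by auto
      have "n1 \<le> length u" using \<open>k < k0\<close> u by (simp add: n_def)
      hence "contraction \<alpha> ^ length u \<le> contraction \<alpha> ^ n1"
        using contraction_bounds[OF \<alpha>] by (intro power_decreasing) auto
      hence d: "3 * contraction \<alpha> ^ length u \<le> \<epsilon> / 8" using n1 by simp
      have "x' \<in> Q" if "x' \<in> cylinder \<alpha> u" for x'
      proof -
        have "\<bar>x - x'\<bar> \<le> \<epsilon> / 8" using cylinder_diam[OF \<alpha> u(3) that] d by linarith
        moreover have "a + \<epsilon> / 8 < x" "x < b - \<epsilon> / 8" using False x unfolding Q_def by auto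
        ultimately have "a \<le> x'" "x' \<le> b" by linarith+
        thus ?thesis unfolding Q_def by simp
      qed
      hence "u \<in> H" using u by (auto simp: H_def)
      thus ?thesis using u(3) by blast
    qed blast
  qed
  hence "\<epsilon> \<le> ?m (exceptional \<alpha> \<union> (?X \<union> (?L \<union> (?R \<union> ?U))))"
    unfolding \<epsilon>_def using U Xb exceptional_null by (intro unif_Kin.finite_measure_mono) auto
  also have "\<dots> \<le> ?m (exceptional \<alpha>) + (?m ?X + (?m ?L + (?m ?R + ?m ?U)))"
    using U Xb exceptional_null by (intro order_trans[OF measure_Un_le] add_left_mono) auto
  also have "?m ?X \<le> \<epsilon> / 4"
  proof -
    have "?m ?X \<le> (\<Sum>k\<in>{k0..n}. ?m (bad_part \<alpha> n k UNIV))"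
      using bad_part_borel[OF \<alpha>] by (intro unif_Kin.finite_measure_subadditive_finite) auto
    also have "\<dots> \<le> (\<Sum>k\<in>{k0..n}. bad_weight \<alpha> k)"
    proof (rule sum_mono)
      fix k
      have "?m (bad_part \<alpha> n k UNIV) \<le> bad_weight \<alpha> k * ?m (full_part \<alpha> (n - k)) * ?m UNIV" by (rule bad_part_le[OF \<alpha>]) simp
      also have "\<dots> \<le> bad_weight \<alpha> k * 1 * 1"
        using bad_weight_nonneg[OF \<alpha>] by (intro mult_mono) auto
      finally show "?m (bad_part \<alpha> n k UNIV) \<le> bad_weight \<alpha> k" by simp
    qed
    also have "\<dots> \<le> \<epsilon> / 4" by (rule k0)
    finally show ?thesis .
  qed
  also have "?m ?L \<le> \<epsilon> / 8" using measure_unif_Kin_interval_le[of a "a + \<epsilon> / 8" \<alpha>] \<epsilon> by simp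
  also have "?m ?R \<le> \<epsilon> / 8" using measure_unif_Kin_interval_le[of "b - \<epsilon> / 8" b \<alpha>] \<epsilon> by simp
  finally have "\<epsilon> / 2 \<le> ?m ?U" using exceptional_null by simp
  thus ?thesis unfolding \<epsilon>_def H_def by blast
qed

text \<open>\<open>full_cylinder_mixing\<close> is summed over disjoint full cylinders of bounded
  order filling half of the interval. The constant is chosen before the interval, as exactness
  requires; only the waiting time N depends on it.\<close>

lemma interval_mixing:
  "\<exists>c>0. \<forall>a b. \<exists>N. \<forall>n\<ge>N. \<forall>B\<in>sets borel.
     c * measure (unif_Kin \<alpha>) {a..b} * measure (unif_Kin \<alpha>) B \<le> measure (unif_Kin \<alpha>) ({a..b} \<inter> (tau \<alpha> ^^ n) -` B)"
proof -
  let ?m = "measure (unif_Kin \<alpha>)"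
  obtain c where c: "c > 0" "\<And>u n B. full \<alpha> u \<Longrightarrow> length u \<le> n \<Longrightarrow> B \<in> sets borel \<Longrightarrow>
     c * ?m B * ?m (cylinder \<alpha> u) \<le> ?m (cylinder \<alpha> u \<inter> (tau \<alpha> ^^ n) -` B)"
    using full_cylinder_mixing by blast
  have "\<exists>N. \<forall>n\<ge>N. \<forall>B\<in>sets borel. c / 2 * ?m {a..b} * ?m B \<le> ?m ({a..b} \<inter> (tau \<alpha> ^^ n) -` B)" for a b
  proof (cases "?m {a..b} > 0")
    case True
    define Q where "Q = {a..b}"
    obtain N where N: "?m Q / 2 \<le> ?m (\<Union>u\<in>{u. full \<alpha> u \<and> length u \<le> N \<and> cylinder \<alpha> u \<subseteq> Q}. cylinder \<alpha> u)"
      using interval_exhausted[OF True] unfolding Q_def by blast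
    define H where "H = {u. full \<alpha> u \<and> length u \<le> N \<and> cylinder \<alpha> u \<subseteq> Q}"
    \<comment> \<open>the prefix-minimal words of \<open>H\<close> have disjoint cylinders with the same union\<close>
    define H' where "H' = {u \<in> H. \<forall>j<length u. take j u \<notin> H}"
    have sub: "(\<Union>u\<in>H. cylinder \<alpha> u) \<subseteq> (\<Union>u\<in>H'. cylinder \<alpha> u)"
    proof
      fix x assume "x \<in> (\<Union>u\<in>H. cylinder \<alpha> u)"
      then obtain u where u: "u \<in> H" "x \<in> cylinder \<alpha> u" by blast
      define j where "j = (LEAST j. take j u \<in> H)"
      have j: "take j u \<in> H" unfolding j_def by (rule LeastI[of _ "length u"]) (use u in simp)
      have "take i (take j u) \<notin> H" if "i < length (take j u)" for i
        using not_less_Least[of i "\<lambda>j. take j u \<in> H"] that unfolding j_def[symmetric] by (auto simp: min_def split: if_splits)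
      hence "take j u \<in> H'" using j by (auto simp: H'_def)
      moreover have "x \<in> cylinder \<alpha> (take j u)" using u(2) cylinder_take by blast
      ultimately show "x \<in> (\<Union>u\<in>H'. cylinder \<alpha> u)" by blast
    qed
    have prefix_eq: "u = v" if "u \<in> H'" "v \<in> H'" "x \<in> cylinder \<alpha> u" "x \<in> cylinder \<alpha> v" "length u \<le> length v" for u v x
    proof -
      have "take (length u) v = u" using cylinder_digit_list_take[OF that(4,5)] cylinder_digit_list[OF that(3)] by simp
      moreover have "\<not> length u < length v"
        using that(1,2) calculation unfolding H'_def by auto
      ultimately show ?thesis using that(5) by simp
    qed
    have disj: "disjoint_family_on (cylinder \<alpha>) H'"
      unfolding disjoint_family_on_def using prefix_eq by (metis disjoint_iff nle_le)
    let ?U = "\<Union>u\<in>H'. cylinder \<alpha> u"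
    have U: "?U \<in> sets borel" by (intro sets.countable_UN') auto
    have UQ: "?U \<subseteq> Q" unfolding H'_def H_def by auto
    have "?m (\<Union>u\<in>H. cylinder \<alpha> u) \<le> ?m ?U" using sub U by (intro unif_Kin.finite_measure_mono) auto
    hence half: "?m Q / 2 \<le> ?m ?U" using N unfolding H_def by linarith
    have "c / 2 * ?m Q * ?m B \<le> ?m (Q \<inter> (tau \<alpha> ^^ n) -` B)" if n: "n \<ge> N" and B: "B \<in> sets borel" for n B
    proof -
      have "c / 2 * ?m Q * ?m B = c * ?m B * (?m Q / 2)" by simp
      also have "\<dots> \<le> c * ?m B * ?m ?U" using half c by (intro mult_left_mono) auto
      also have "\<dots> \<le> 1 * ?m (?U \<inter> (tau \<alpha> ^^ n) -` B)"
      proof (rule unif_Kin.measure_UN_mono)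
        fix u assume "u \<in> H'"
        hence "full \<alpha> u" "length u \<le> n" using n unfolding H'_def H_def by auto
        thus "c * ?m B * ?m (cylinder \<alpha> u) \<le> 1 * ?m (cylinder \<alpha> u \<inter> (tau \<alpha> ^^ n) -` B)" using c(2) B by simp
      qed (use c B disj in auto)
      also have "\<dots> \<le> ?m (Q \<inter> (tau \<alpha> ^^ n) -` B)"
        using UQ B by (simp, intro unif_Kin.finite_measure_mono) (auto simp: Q_def)
      finally show ?thesis .
    qed
    thus ?thesis unfolding Q_def by blast
  next
    case False
    hence "?m {a..b} = 0" by (simp add: zero_less_measure_iff)
    thus ?thesis by simp
  qed
  moreover have "c / 2 > 0" using c by simp
  ultimately show ?thesis by blast
qed

end

section \<open>Product measures on Euclidean space\<close>

definition rect :: "('n \<Rightarrow> real set) \<Rightarrow> (real^'n) set" where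
  "rect A = {x. \<forall>i. x $ i \<in> A i}"

lemma rect_Int: "rect A \<inter> rect B = rect (\<lambda>i. A i \<inter> B i)"
  by (auto simp: rect_def)

lemma vec_lambda_measurable_PiM:
  assumes "\<And>i. sets (M i) = sets (borel :: real measure)"
  shows "(\<lambda>f. \<chi> i. f i) \<in> measurable (PiM UNIV M) (borel :: (real^'n) measure)"
proof (rule borel_measurable_euclidean_space[THEN iffD2, rule_format])
  fix b :: "real^'n" assume "b \<in> Basis"
  then obtain i where b: "b = axis i 1" by (auto simp: Basis_vec_def)
  have "(\<lambda>f. f i) \<in> measurable (PiM UNIV M) (M i)" by (rule measurable_component_singleton) simp
  hence "(\<lambda>f. f i) \<in> borel_measurable (PiM UNIV M)" using assms measurable_cong_sets by blast
  thus "(\<lambda>f. (\<chi> i. f i) \<bullet> b) \<in> borel_measurable (PiM UNIV M)"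
    by (simp add: b inner_axis)
qed

lemma rect_borel [measurable, simp]:
  assumes "\<And>i. A i \<in> sets borel"
  shows "rect A \<in> sets (borel :: (real^'n) measure)"
proof -
  have "rect A = (\<Inter>i. (\<lambda>x. x $ i) -` A i)" by (auto simp: rect_def)
  also have "\<dots> \<in> sets borel"
    using measurable_sets[OF borel_measurable_nth] assms
    by (intro sets.countable_INT'') (auto simp: vimage_def)
  finally show ?thesis .
qed

lemma vec_nth_measurable_PiM:
  assumes "\<And>i. sets (M i) = sets (borel :: real measure)"
  shows "(\<lambda>x i. x $ i) \<in> measurable (borel :: (real^'n) measure) (PiM UNIV M)"
proof (rule measurable_PiM_single')
  fix i :: 'n
  have "(\<lambda>x. x $ i) \<in> borel_measurable (borel :: (real^'n) measure)" by measurable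
  thus "(\<lambda>x. x $ i) \<in> measurable borel (M i)" using assms measurable_cong_sets by blast
qed (use sets_eq_imp_space_eq[OF assms] in auto)

text \<open>Lebesgue measure is identified with the product of its one-dimensional copies by their
  agreement on open boxes; the formula then holds for all Borel rectangles.\<close>

lemma emeasure_lborel_rect:
  assumes A: "\<And>i. A i \<in> sets borel"
  shows "emeasure lborel (rect A :: (real^'n) set) = (\<Prod>i\<in>UNIV. emeasure lborel (A i))"
proof -
  let ?P = "PiM UNIV (\<lambda>_::'n. lborel :: real measure)"
  interpret product_sigma_finite "\<lambda>_::'n. lborel :: real measure" by standard
  have v: "(\<lambda>f. \<chi> i. f i) \<in> measurable ?P (borel :: (real^'n) measure)"
    by (rule vec_lambda_measurable_PiM) simp
  have vi: "(\<lambda>f. \<chi> i. f i) -` rect B \<inter> space ?P = PiE UNIV B" for B :: "'n \<Rightarrow> real set"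
    by (auto simp: rect_def space_PiM PiE_iff)
  have P: "emeasure (distr ?P borel (\<lambda>f. \<chi> i. f i)) (rect B :: (real^'n) set)
      = (\<Prod>i\<in>UNIV. emeasure lborel (B i))" if "\<And>i. B i \<in> sets borel" for B
    using that v by (subst emeasure_distr) (auto simp: vi emeasure_PiM)
  have "lborel = distr ?P borel (\<lambda>f. \<chi> i. f i)"
  proof (rule lborel_eqI)
    fix l u :: "real^'n" assume le: "\<And>b. b \<in> Basis \<Longrightarrow> l \<bullet> b \<le> u \<bullet> b"
    have le': "l $ i \<le> u $ i" for i
      using le[of "axis i 1"] by (simp add: inner_axis axis_in_Basis_iff)
    have "box l u = rect (\<lambda>i. {l $ i<..<u $ i})"
      by (auto simp: rect_def mem_box_cart)
    hence "emeasure (distr ?P borel (\<lambda>f. \<chi> i. f i)) (box l u) = (\<Prod>i\<in>UNIV. ennreal (u $ i - l $ i))"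
      using le' by (simp add: P)
    also have "\<dots> = (\<Prod>i\<in>UNIV. ennreal ((u - l) \<bullet> axis i 1))"
      by (simp add: inner_axis)
    also have "\<dots> = (\<Prod>b\<in>(\<lambda>i. axis i 1) ` UNIV. ennreal ((u - l) \<bullet> b))"
      by (subst prod.reindex) (auto simp: inj_on_def axis_eq_axis)
    also have "(\<lambda>i. axis i 1) ` UNIV = (Basis :: (real^'n) set)"
      by (auto simp: Basis_vec_def)
    finally show "emeasure (distr ?P borel (\<lambda>f. \<chi> i. f i)) (box l u) = (\<Prod>b\<in>Basis. (u - l) \<bullet> b)"
      using le by (simp add: prod_ennreal algebra_simps)
  qed simp
  thus ?thesis using P[OF A] by simp
qed

text \<open>A measure that factors on rectangles is a product measure, by uniqueness on the product
  of the factors. This applies to the uniform measure and to its pushforwards alike.\<close>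

lemma measure_eq_distr_PiM:
  fixes \<mu> :: "(real^'n) measure"
  assumes \<mu>: "sets \<mu> = sets borel" and M: "\<And>i. finite_measure (M i)" "\<And>i. sets (M i) = sets borel"
    and eq: "\<And>A. (\<And>i. A i \<in> sets borel) \<Longrightarrow> emeasure \<mu> (rect A) = (\<Prod>i\<in>UNIV. emeasure (M i) (A i))"
  shows "\<mu> = distr (PiM UNIV M) borel (\<lambda>f. \<chi> i. f i)"
proof -
  interpret product_sigma_finite M
    by (rule product_sigma_finite.intro) (rule finite_measure.axioms(1)[OF M(1)])
  have n: "(\<lambda>x i. x $ i) \<in> measurable \<mu> (PiM UNIV M)"
    using vec_nth_measurable_PiM[OF M(2)] by (simp add: measurable_cong_sets[OF \<mu> refl])
  have sp: "space \<mu> = UNIV" using sets_eq_imp_space_eq[OF \<mu>] by simp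
  have v: "(\<lambda>f. \<chi> i. f i) \<in> measurable (PiM UNIV M) (borel :: (real^'n) measure)"
    by (rule vec_lambda_measurable_PiM) (rule M)
  have "distr \<mu> (PiM UNIV M) (\<lambda>x i. x $ i) = PiM UNIV M"
  proof (rule PiM_eqI)
    fix A assume A: "\<And>i. i \<in> UNIV \<Longrightarrow> A i \<in> sets (M i)"
    have vi: "(\<lambda>x i. x $ i) -` (PiE UNIV A) \<inter> space \<mu> = rect A"
      unfolding sp rect_def vimage_def PiE_def by auto
    have A': "A i \<in> sets borel" for i using A[of i] M(2)[of i] by simp
    have "PiE UNIV A \<in> sets (PiM UNIV M)" using A by (intro sets_PiM_I_finite) simp_all
    thus "emeasure (distr \<mu> (PiM UNIV M) (\<lambda>x i. x $ i)) (PiE UNIV A) = (\<Prod>i\<in>UNIV. emeasure (M i) (A i))"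
      using eq[OF A'] n by (simp add: emeasure_distr vi)
  qed simp_all
  hence "distr (PiM UNIV M) borel (\<lambda>f. \<chi> i. f i)
      = distr (distr \<mu> (PiM UNIV M) (\<lambda>x i. x $ i)) borel (\<lambda>f. \<chi> i. f i)" by simp
  also have "\<dots> = distr \<mu> borel ((\<lambda>f. \<chi> i. f i) \<circ> (\<lambda>x i. x $ i))"
    using v n by (rule distr_distr)
  also have "\<dots> = distr \<mu> \<mu> (\<lambda>x. x)" by (rule distr_cong) (simp_all add: \<mu>)
  also have "\<dots> = \<mu>" by (rule distr_id2) (rule refl)
  finally show ?thesis by (rule sym)
qed

lemma nn_integral_le_scale:
  assumes "sets N = sets M" and "\<And>B. B \<in> sets M \<Longrightarrow> emeasure N B \<le> c * emeasure M B"
    and "f \<in> borel_measurable M"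
  shows "nn_integral N f \<le> c * nn_integral M f"
proof -
  have "N \<le> scale_measure c M" using assms(1,2) by (subst le_measure) auto
  hence "nn_integral N f \<le> nn_integral (scale_measure c M) f"
    using assms(1) by (intro nn_integral_mono_measure) auto
  thus ?thesis using assms(3) by (simp add: nn_integral_scale_measure)
qed

lemma nn_integral_PiM_le_scale:
  assumes M: "product_sigma_finite M" and N: "product_sigma_finite N"
    and sets: "\<And>i. sets (N i) = sets (M i)"
    and le: "\<And>i B. B \<in> sets (M i) \<Longrightarrow> emeasure (N i) B \<le> c i * emeasure (M i) B"
    and "finite I" and "f \<in> borel_measurable (PiM I M)"
  shows "nn_integral (PiM I N) f \<le> (\<Prod>i\<in>I. c i) * nn_integral (PiM I M) f"
  using assms(5,6)
proof (induction I arbitrary: f rule: finite_induct)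
  case empty
  show ?case by (simp add: PiM_empty)
next
  case (insert i I)
  have eqs: "sets (PiM J N) = sets (PiM J M)" for J by (rule sets_PiM_cong) (auto simp: sets)
  have f: "f \<in> borel_measurable (PiM (insert i I) M)" "f \<in> borel_measurable (PiM (insert i I) N)"
    using insert.prems measurable_cong_sets[OF eqs refl] by auto
  have f2: "(\<lambda>(x, y). f (x(i := y))) \<in> borel_measurable (PiM I M \<Otimes>\<^sub>M M i)"
    using insert.prems measurable_comp[OF measurable_add_dim[of i I M]] by (simp add: comp_def case_prod_unfold)
  have sf: "sigma_finite_measure (M i)" using M by (simp add: product_sigma_finite_def)
  have in1: "(\<lambda>x. \<integral>\<^sup>+y. f (x(i := y)) \<partial>M i) \<in> borel_measurable (PiM I M)"
    using sigma_finite_measure.borel_measurable_nn_integral[OF sf f2] .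
  have "nn_integral (PiM (insert i I) N) f = (\<integral>\<^sup>+x. \<integral>\<^sup>+y. f (x(i := y)) \<partial>N i \<partial>PiM I N)"
    using product_sigma_finite.product_nn_integral_insert[OF N insert.hyps f(2)] .
  also have "\<dots> \<le> (\<integral>\<^sup>+x. c i * (\<integral>\<^sup>+y. f (x(i := y)) \<partial>M i) \<partial>PiM I N)"
  proof (rule nn_integral_mono)
    fix x assume "x \<in> space (PiM I N)"
    hence "x \<in> space (PiM I M)" using sets_eq_imp_space_eq[OF eqs] by simp
    hence "(\<lambda>y. f (x(i := y))) \<in> borel_measurable (M i)"
      using measurable_Pair2[OF f2] by simp
    thus "(\<integral>\<^sup>+y. f (x(i := y)) \<partial>N i) \<le> c i * (\<integral>\<^sup>+y. f (x(i := y)) \<partial>M i)"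
      using sets le by (intro nn_integral_le_scale) auto
  qed
  also have "\<dots> \<le> (\<Prod>i\<in>I. c i) * (\<integral>\<^sup>+x. c i * (\<integral>\<^sup>+y. f (x(i := y)) \<partial>M i) \<partial>PiM I M)"
    by (intro insert.IH borel_measurable_times_ennreal borel_measurable_const in1)
  also have "\<dots> = (\<Prod>i\<in>I. c i) * (c i * nn_integral (PiM (insert i I) M) f)"
    using in1 product_sigma_finite.product_nn_integral_insert[OF M insert.hyps f(1)]
    by (simp add: nn_integral_cmult)
  also have "\<dots> = (\<Prod>i\<in>insert i I. c i) * nn_integral (PiM (insert i I) M) f"
    using insert.hyps by (simp add: mult_ac)
  finally show ?case .
qed

text \<open>The device by which one-dimensional estimates, with their constants multiplied, pass to
  arbitrary Borel sets of the product.\<close>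

lemma rect_measure_le:
  fixes \<mu> \<nu> :: "(real^'n) measure"
  assumes sets: "sets \<mu> = sets borel" "sets \<nu> = sets borel"
    and fin: "\<And>i. finite_measure (M i)" "\<And>i. finite_measure (N i)"
    and sets': "\<And>i. sets (M i) = sets borel" "\<And>i. sets (N i) = sets borel"
    and \<mu>: "\<And>A. (\<And>i. A i \<in> sets borel) \<Longrightarrow> emeasure \<mu> (rect A) = (\<Prod>i\<in>UNIV. emeasure (M i) (A i))"
    and \<nu>: "\<And>A. (\<And>i. A i \<in> sets borel) \<Longrightarrow> emeasure \<nu> (rect A) = (\<Prod>i\<in>UNIV. emeasure (N i) (A i))"
    and c: "\<And>i. c i \<ge> 0"
    and le: "\<And>i B. B \<in> sets borel \<Longrightarrow> measure (N i) B \<le> c i * measure (M i) B"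
    and B: "B \<in> sets borel"
  shows "emeasure \<nu> B \<le> ennreal (\<Prod>i\<in>UNIV. c i) * emeasure \<mu> B"
proof -
  have PM: "product_sigma_finite M" "product_sigma_finite N"
    by (auto intro!: product_sigma_finite.intro finite_measure.axioms(1) fin)
  have eqM: "\<mu> = distr (PiM UNIV M) borel (\<lambda>f. \<chi> i. f i)"
    and eqN: "\<nu> = distr (PiM UNIV N) borel (\<lambda>f. \<chi> i. f i)"
    using sets fin sets' \<mu> \<nu> by (auto intro!: measure_eq_distr_PiM)
  have v: "(\<lambda>f. \<chi> i. f i) \<in> measurable (PiM UNIV M) (borel :: (real^'n) measure)"
    "(\<lambda>f. \<chi> i. f i) \<in> measurable (PiM UNIV N) (borel :: (real^'n) measure)"
    using sets' by (auto intro!: vec_lambda_measurable_PiM)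
  let ?S = "(\<lambda>f. \<chi> i. f i) -` B"
  have S: "?S \<inter> space (PiM UNIV M) \<in> sets (PiM UNIV M)" "?S \<inter> space (PiM UNIV N) \<in> sets (PiM UNIV N)"
    using v B by (auto intro: measurable_sets)
  have sp: "space (PiM UNIV N) = space (PiM UNIV M)"
    using sets' by (intro sets_eq_imp_space_eq sets_PiM_cong) auto
  have "emeasure \<nu> B = nn_integral (PiM UNIV N) (indicator (?S \<inter> space (PiM UNIV M)))"
    using v(2) B S sp by (simp add: eqN emeasure_distr)
  also have "\<dots> \<le> (\<Prod>i\<in>UNIV. ennreal (c i)) * nn_integral (PiM UNIV M) (indicator (?S \<inter> space (PiM UNIV M)))"
  proof (rule nn_integral_PiM_le_scale[OF PM])
    fix i A assume "A \<in> sets (M i)"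
    hence "measure (N i) A \<le> c i * measure (M i) A" using le sets' by auto
    thus "emeasure (N i) A \<le> ennreal (c i) * emeasure (M i) A"
      using fin c by (simp add: finite_measure.emeasure_eq_measure ennreal_mult'[symmetric])
  qed (use sets' S in auto)
  also have "\<dots> = ennreal (\<Prod>i\<in>UNIV. c i) * emeasure \<mu> B"
    using v(1) B S c by (simp add: eqM emeasure_distr prod_ennreal)
  finally show ?thesis .
qed

section \<open>The product map\<close>

lemma T_nth: "T \<alpha> x $ i = tau (\<alpha> $ i) (x $ i)"
  by (simp add: T_def next_digit_def tau_def)

lemma T_pow_nth: "(T \<alpha> ^^ n) x $ i = (tau (\<alpha> $ i) ^^ n) (x $ i)"
  by (induction n) (auto simp: T_nth)

lemma T_pow_measurable [measurable]:
  fixes \<alpha> :: "real^'n"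
  shows "(T \<alpha> ^^ n) \<in> borel_measurable borel"
proof (rule borel_measurable_euclidean_space[THEN iffD2, rule_format])
  fix b :: "real^'n" assume "b \<in> Basis"
  then obtain i where b: "b = axis i 1" by (auto simp: Basis_vec_def)
  have "(\<lambda>x. (tau (\<alpha> $ i) ^^ n) (x $ i)) \<in> borel_measurable borel"
    by (rule measurable_compose[OF borel_measurable_nth tau_pow_measurable])
  thus "(\<lambda>x. (T \<alpha> ^^ n) x \<bullet> b) \<in> borel_measurable borel"
    by (simp add: b inner_axis T_pow_nth)
qed

lemma T_measurable [measurable]: "T \<alpha> \<in> borel_measurable borel"
  using T_pow_measurable[of 1 \<alpha>] by simp

lemma vimage_T_pow [simp, measurable]: "B \<in> sets borel \<Longrightarrow> (T \<alpha> ^^ n) -` B \<in> sets borel"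
  using measurable_sets[OF T_pow_measurable, of B] by simp

abbreviation Kvec :: "real^'n \<Rightarrow> (real^'n) set" where
  "Kvec \<alpha> \<equiv> rect (\<lambda>i. Kin (\<alpha> $ i))"

definition unif_Kvec :: "real^'n \<Rightarrow> (real^'n) measure" where
  "unif_Kvec \<alpha> = uniform_measure lborel (Kvec \<alpha>)"

lemma sets_unif_Kvec [simp, measurable_cong]: "sets (unif_Kvec \<alpha>) = sets borel"
  by (simp add: unif_Kvec_def)

lemma space_unif_Kvec [simp]: "space (unif_Kvec \<alpha>) = UNIV"
  by (simp add: unif_Kvec_def)

lemma emeasure_Kvec: "emeasure lborel (Kvec \<alpha>) = 1"
  by (simp add: emeasure_lborel_rect emeasure_Kin)

lemma emeasure_unif_Kvec: "A \<in> sets borel \<Longrightarrow> emeasure (unif_Kvec \<alpha>) A = emeasure lborel (Kvec \<alpha> \<inter> A)"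
  by (simp add: unif_Kvec_def emeasure_Kvec divide_ennreal_def)

lemma measure_unif_Kvec: "A \<in> sets borel \<Longrightarrow> measure (unif_Kvec \<alpha>) A = measure lborel (Kvec \<alpha> \<inter> A)"
  by (simp add: measure_def emeasure_unif_Kvec)

interpretation unif_Kvec: prob_space "unif_Kvec \<alpha>" for \<alpha>
  unfolding unif_Kvec_def by (rule prob_space_uniform_measure) (simp_all add: emeasure_Kvec)

lemma emeasure_unif_Kvec_rect:
  assumes "\<And>i. A i \<in> sets borel"
  shows "emeasure (unif_Kvec \<alpha>) (rect A) = (\<Prod>i\<in>UNIV. emeasure (unif_Kin (\<alpha> $ i)) (A i))"
  using assms by (simp add: emeasure_unif_Kvec rect_Int emeasure_lborel_rect emeasure_unif_Kin)

lemma measure_unif_Kvec_rect: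
  assumes "\<And>i. A i \<in> sets borel"
  shows "measure (unif_Kvec \<alpha>) (rect A) = (\<Prod>i\<in>UNIV. measure (unif_Kin (\<alpha> $ i)) (A i))"
  using emeasure_unif_Kvec_rect[OF assms, of \<alpha>]
  by (simp add: unif_Kvec.emeasure_eq_measure unif_Kin.emeasure_eq_measure prod_ennreal prod_nonneg)

text \<open>Turns the mass of points of Q sent into a set by f into a measure of that set. Both
  mixing and domination then become comparisons of product measures.\<close>

definition pushed :: "'a measure \<Rightarrow> 'a set \<Rightarrow> ('a \<Rightarrow> 'a) \<Rightarrow> 'a measure" where
  "pushed M Q f = distr (density M (indicator Q)) M f"

lemma sets_pushed [simp]: "sets (pushed M Q f) = sets M"
  by (simp add: pushed_def)

lemma emeasure_pushed:
  assumes "space M = UNIV" "Q \<in> sets M" "f \<in> measurable M M" "A \<in> sets M"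
  shows "emeasure (pushed M Q f) A = emeasure M (Q \<inter> f -` A)"
proof -
  have s: "f -` A \<in> sets M" using measurable_sets[OF assms(3,4)] assms(1) by simp
  have "f \<in> measurable (density M (indicator Q)) M" using assms(3) by simp
  hence "emeasure (pushed M Q f) A = emeasure (density M (indicator Q)) (f -` A)"
    using assms(1,4) by (simp add: pushed_def emeasure_distr)
  also have "\<dots> = (\<integral>\<^sup>+x. indicator Q x * indicator (f -` A) x \<partial>M)"
    using s assms(2) by (simp add: emeasure_density)
  also have "\<dots> = emeasure M (Q \<inter> f -` A)"
    using s assms(2) by (simp flip: indicator_inter_arith)
  finally show ?thesis .
qed

lemma finite_measure_pushed:
  assumes "finite_measure M" "space M = UNIV" "Q \<in> sets M" "f \<in> measurable M M"
  shows "finite_measure (pushed M Q f)"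
proof (rule finite_measureI)
  have "emeasure (pushed M Q f) UNIV = emeasure M Q"
    using emeasure_pushed[OF assms(2-4)] sets.top[of M] assms(2) by simp
  thus "emeasure (pushed M Q f) (space (pushed M Q f)) \<noteq> \<infinity>"
    using finite_measure.emeasure_finite[OF assms(1)] assms(2) by (simp add: pushed_def)
qed

lemma emeasure_pushed_unif_Kvec_rect:
  assumes Q: "\<And>i. Q i \<in> sets borel" and A: "\<And>i. A i \<in> sets borel"
  shows "emeasure (pushed (unif_Kvec \<alpha>) (rect Q) (T \<alpha> ^^ n)) (rect A)
    = (\<Prod>i\<in>UNIV. emeasure (pushed (unif_Kin (\<alpha> $ i)) (Q i) (tau (\<alpha> $ i) ^^ n)) (A i))"
proof -
  have "rect Q \<inter> (T \<alpha> ^^ n) -` rect A = rect (\<lambda>i. Q i \<inter> (tau (\<alpha> $ i) ^^ n) -` A i)"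
    by (auto simp: rect_def T_pow_nth)
  thus ?thesis using Q A
    by (simp add: emeasure_pushed emeasure_unif_Kvec_rect)
qed

lemma T_vimage_le:
  fixes \<alpha> :: "real^'n"
  assumes \<alpha>: "\<forall>i. \<alpha> $ i \<in> {0..1}"
  shows "\<exists>C\<ge>0. \<forall>n. \<forall>B\<in>sets borel. measure (unif_Kvec \<alpha>) ((T \<alpha> ^^ n) -` B) \<le> C * measure (unif_Kvec \<alpha>) B"
proof (intro exI conjI allI ballI)
  let ?c = "\<lambda>i. suminf (bad_weight (\<alpha> $ i))"
  have c: "?c i \<ge> 0" for i using \<alpha> by (intro suminf_nonneg summable_bad_weight bad_weight_nonneg) auto
  show "(\<Prod>i\<in>UNIV. ?c i) \<ge> 0" using c by (intro prod_nonneg) auto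
  fix n and B :: "(real^'n) set" assume B: "B \<in> sets borel"
  have "emeasure (pushed (unif_Kvec \<alpha>) (rect (\<lambda>_. UNIV)) (T \<alpha> ^^ n)) B \<le> ennreal (\<Prod>i\<in>UNIV. ?c i) * emeasure (unif_Kvec \<alpha>) B"
  proof (rule rect_measure_le[where M = "\<lambda>i. unif_Kin (\<alpha> $ i)" and N = "\<lambda>i. pushed (unif_Kin (\<alpha> $ i)) UNIV (tau (\<alpha> $ i) ^^ n)"])
    fix i and B :: "real set" assume "B \<in> sets borel"
    moreover have "measure (pushed (unif_Kin (\<alpha> $ i)) UNIV (tau (\<alpha> $ i) ^^ n)) B = measure (unif_Kin (\<alpha> $ i)) ((tau (\<alpha> $ i) ^^ n) -` B)"
      using calculation by (simp add: measure_def emeasure_pushed)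
    ultimately show "measure (pushed (unif_Kin (\<alpha> $ i)) UNIV (tau (\<alpha> $ i) ^^ n)) B \<le> ?c i * measure (unif_Kin (\<alpha> $ i)) B"
      using vimage_le \<alpha> by simp
  qed (use c B in \<open>auto simp: emeasure_unif_Kvec_rect emeasure_pushed_unif_Kvec_rect unif_Kin.finite_measure_axioms intro!: finite_measure_pushed\<close>)
  moreover have "rect (\<lambda>_. UNIV) = (UNIV :: (real^'n) set)" by (auto simp: rect_def)
  ultimately have "emeasure (unif_Kvec \<alpha>) ((T \<alpha> ^^ n) -` B) \<le> ennreal (\<Prod>i\<in>UNIV. ?c i) * emeasure (unif_Kvec \<alpha>) B"
    using B by (simp add: emeasure_pushed)
  thus "measure (unif_Kvec \<alpha>) ((T \<alpha> ^^ n) -` B) \<le> (\<Prod>i\<in>UNIV. ?c i) * measure (unif_Kvec \<alpha>) B"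
    using c by (simp add: unif_Kvec.emeasure_eq_measure ennreal_mult'[symmetric] prod_nonneg)
qed

text \<open>One-dimensional mixing says that the uniform measure is dominated by
  \<open>1 / (c i * q i)\<close> times the pushed measure; this form passes to products. Boxes of
  mass zero are split off to make all q i positive, and the maximum of the finitely many waiting
  times serves for all coordinates.\<close>

lemma box_mixing:
  assumes \<alpha>: "\<forall>i. \<alpha> $ i \<in> {0..1}"
  shows "\<exists>c>0. \<forall>a b. \<exists>N. \<forall>n\<ge>N. \<forall>B\<in>sets borel.
     c * measure (unif_Kvec \<alpha>) (cbox a b) * measure (unif_Kvec \<alpha>) B \<le> measure (unif_Kvec \<alpha>) (cbox a b \<inter> (T \<alpha> ^^ n) -` B)"
proof -
  have "\<forall>i. \<exists>c>0. \<forall>a b. \<exists>N. \<forall>n\<ge>N. \<forall>B\<in>sets borel.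
     c * measure (unif_Kin (\<alpha> $ i)) {a..b} * measure (unif_Kin (\<alpha> $ i)) B \<le> measure (unif_Kin (\<alpha> $ i)) ({a..b} \<inter> (tau (\<alpha> $ i) ^^ n) -` B)"
    using interval_mixing \<alpha> by blast
  then obtain c where c: "\<And>i. c i > (0::real)"
    and cc: "\<And>i a b. \<exists>N. \<forall>n\<ge>N. \<forall>B\<in>sets borel.
     c i * measure (unif_Kin (\<alpha> $ i)) {a..b} * measure (unif_Kin (\<alpha> $ i)) B \<le> measure (unif_Kin (\<alpha> $ i)) ({a..b} \<inter> (tau (\<alpha> $ i) ^^ n) -` B)"
    by metis
  have "\<exists>N. \<forall>n\<ge>N. \<forall>B\<in>sets borel. (\<Prod>i\<in>UNIV. c i) * measure (unif_Kvec \<alpha>) (cbox a b) * measure (unif_Kvec \<alpha>) B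
      \<le> measure (unif_Kvec \<alpha>) (cbox a b \<inter> (T \<alpha> ^^ n) -` B)" for a b
  proof (cases "measure (unif_Kvec \<alpha>) (cbox a b) = 0")
    case False
    define Q where "Q = (\<lambda>i. {a $ i..b $ i})"
    define q where "q = (\<lambda>i. measure (unif_Kin (\<alpha> $ i)) (Q i))"
    have Q: "cbox a b = rect Q" "\<And>i. Q i \<in> sets borel" by (auto simp: rect_def mem_box_cart Q_def)
    have mQ: "measure (unif_Kvec \<alpha>) (cbox a b) = (\<Prod>i\<in>UNIV. q i)"
      using Q by (simp add: measure_unif_Kvec_rect q_def)
    hence "q i \<noteq> 0" for i using False by (simp add: prod_zero_iff)
    hence q: "q i > 0" for i unfolding q_def by (simp add: zero_less_measure_iff)
    have "\<forall>i. \<exists>N. \<forall>n\<ge>N. \<forall>B\<in>sets borel.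
     c i * q i * measure (unif_Kin (\<alpha> $ i)) B \<le> measure (unif_Kin (\<alpha> $ i)) (Q i \<inter> (tau (\<alpha> $ i) ^^ n) -` B)"
      unfolding q_def Q_def using cc by blast
    then obtain N where N: "\<And>i n B. n \<ge> N i \<Longrightarrow> B \<in> sets borel \<Longrightarrow>
     c i * q i * measure (unif_Kin (\<alpha> $ i)) B \<le> measure (unif_Kin (\<alpha> $ i)) (Q i \<inter> (tau (\<alpha> $ i) ^^ n) -` B)"
      by metis
    have "(\<Prod>i\<in>UNIV. c i) * measure (unif_Kvec \<alpha>) (cbox a b) * measure (unif_Kvec \<alpha>) B
      \<le> measure (unif_Kvec \<alpha>) (cbox a b \<inter> (T \<alpha> ^^ n) -` B)"
      if n: "n \<ge> Max (range N)" and B: "B \<in> sets borel" for n B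
    proof -
      let ?k = "\<lambda>i. 1 / (c i * q i)"
      have nN: "n \<ge> N i" for i using n by (simp add: Max_ge order_trans)
      have k: "?k i > 0" for i using c q by simp
      have "emeasure (unif_Kvec \<alpha>) B \<le> ennreal (\<Prod>i\<in>UNIV. ?k i) * emeasure (pushed (unif_Kvec \<alpha>) (rect Q) (T \<alpha> ^^ n)) B"
      proof (rule rect_measure_le[where N = "\<lambda>i. unif_Kin (\<alpha> $ i)" and M = "\<lambda>i. pushed (unif_Kin (\<alpha> $ i)) (Q i) (tau (\<alpha> $ i) ^^ n)"])
        fix i and B :: "real set" assume B: "B \<in> sets borel"
        have "measure (pushed (unif_Kin (\<alpha> $ i)) (Q i) (tau (\<alpha> $ i) ^^ n)) B = measure (unif_Kin (\<alpha> $ i)) (Q i \<inter> (tau (\<alpha> $ i) ^^ n) -` B)"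
          using B Q by (simp add: measure_def emeasure_pushed)
        thus "measure (unif_Kin (\<alpha> $ i)) B \<le> ?k i * measure (pushed (unif_Kin (\<alpha> $ i)) (Q i) (tau (\<alpha> $ i) ^^ n)) B"
          using N[OF nN B, of i] c[of i] q[of i] by (simp add: field_simps)
      next
        show "?k i \<ge> 0" for i using k less_imp_le by blast
      qed (use B Q in \<open>auto simp: emeasure_unif_Kvec_rect emeasure_pushed_unif_Kvec_rect unif_Kin.finite_measure_axioms intro!: finite_measure_pushed\<close>)
      hence "emeasure (unif_Kvec \<alpha>) B \<le> ennreal (\<Prod>i\<in>UNIV. ?k i) * emeasure (unif_Kvec \<alpha>) (cbox a b \<inter> (T \<alpha> ^^ n) -` B)"
        using B Q by (simp add: emeasure_pushed)
      moreover have P: "(\<Prod>i\<in>UNIV. ?k i) > 0" using k by (intro prod_pos) auto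
      ultimately have "measure (unif_Kvec \<alpha>) B \<le> (\<Prod>i\<in>UNIV. ?k i) * measure (unif_Kvec \<alpha>) (cbox a b \<inter> (T \<alpha> ^^ n) -` B)"
        by (simp add: unif_Kvec.emeasure_eq_measure ennreal_mult'[symmetric])
      also have "(\<Prod>i\<in>UNIV. ?k i) = 1 / ((\<Prod>i\<in>UNIV. c i) * measure (unif_Kvec \<alpha>) (cbox a b))"
        by (simp add: mQ prod_dividef prod.distrib)
      finally show ?thesis using P mQ c q prod_pos[of UNIV c] prod_pos[of UNIV q]
        by (simp add: field_simps)
    qed
    thus ?thesis by blast
  qed simp
  moreover have "(\<Prod>i\<in>UNIV. c i) > 0" using c by (intro prod_pos) auto
  ultimately show ?thesis by blast
qed

text \<open>Forward images of Borel sets need not be Borel for general Borel maps. Here there are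
  countably many digits, each with a Borel inverse, so the image is a countable union of Borel
  sets.\<close>

lemma T_image_borel:
  fixes \<alpha> :: "real^'n"
  assumes "A \<in> sets borel"
  shows "T \<alpha> ` A \<in> sets borel"
proof -
  \<comment> \<open>Since \<open>1 / 0 = 0\<close>, this inverts \<open>T \<alpha>\<close> also at points with vanishing coordinates.\<close>
  define inv where "inv = (\<lambda>(a :: int^'n) y. (\<chi> i. 1 / (y $ i + of_int (a $ i))) :: real^'n)"
  have [measurable]: "inv a \<in> borel_measurable borel" for a
  proof (rule borel_measurable_euclidean_space[THEN iffD2, rule_format])
    fix b :: "real^'n" assume "b \<in> Basis"
    then obtain i where b: "b = axis i 1" by (auto simp: Basis_vec_def)
    show "(\<lambda>x. inv a x \<bullet> b) \<in> borel_measurable borel"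
      unfolding b inv_def by (simp add: inner_axis)
  qed
  have i: "inv (next_digit \<alpha> x) (T \<alpha> x) = x" for x
    by (simp add: inv_def T_def vec_eq_iff)
  have "T \<alpha> ` A = (\<Union>a. {y \<in> space borel. inv a y \<in> A \<and> T \<alpha> (inv a y) = y})"
  proof (intro equalityI subsetI)
    fix y assume "y \<in> T \<alpha> ` A"
    then obtain x where "x \<in> A" "y = T \<alpha> x" by blast
    thus "y \<in> (\<Union>a. {y \<in> space borel. inv a y \<in> A \<and> T \<alpha> (inv a y) = y})"
      using i[of x] by (auto intro!: exI[of _ "next_digit \<alpha> x"])
  qed (auto intro!: rev_image_eqI)
  also have "\<dots> \<in> sets borel"
    using assms by (intro sets.countable_UN'[of UNIV] subset_UNIV) (auto, measurable)
  finally show ?thesis .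
qed

lemma T_pow_image_borel: "A \<in> sets borel \<Longrightarrow> (T \<alpha> ^^ n) ` A \<in> sets borel"
proof (induction n)
  case (Suc n)
  have "(T \<alpha> ^^ Suc n) ` A = T \<alpha> ` ((T \<alpha> ^^ n) ` A)" by (simp add: image_image)
  thus ?case using Suc T_image_borel by metis
qed simp

section \<open>Existence of an invariant measure\<close>

text \<open>The invariant measure is a cluster point, in the product topology on set functions, of the
  Cesaro averages; countable additivity survives because the averages are uniformly dominated.\<close>

lemma (in prob_space) invariant_measure_exists:
  assumes f [measurable]: "f \<in> measurable M M"
    and C: "C \<ge> 0" "\<And>n A. A \<in> sets M \<Longrightarrow> prob ((f ^^ n) -` A \<inter> space M) \<le> C * prob A"
    and c: "\<And>n A. n \<ge> N \<Longrightarrow> A \<in> sets M \<Longrightarrow> c * prob A \<le> prob ((f ^^ n) -` A \<inter> space M)"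
  obtains \<mu> where "sets \<mu> = sets M" "prob_space \<mu>" "invariant_measure \<mu> f"
    "\<And>A. A \<in> sets M \<Longrightarrow> c * prob A \<le> measure \<mu> A \<and> measure \<mu> A \<le> C * prob A"
proof -
  define a where "a k A = prob ((f ^^ k) -` A \<inter> space M)" for k A
  \<comment> \<open>Averaging starts at time N, so that the lower bound by c holds for every
    term.\<close>
  define s where "s n A = (\<Sum>k\<le>n. a (N + k) A) / real (Suc n)" for n A
  have fk: "(f ^^ k) \<in> measurable M M" for k by (induction k) (auto intro: measurable_comp)
  have fk_sets: "(f ^^ k) -` A \<inter> space M \<in> sets M" if "A \<in> sets M" for k A
    using measurable_sets[OF fk that] .
  have a01: "0 \<le> a k A" "a k A \<le> 1" for k A by (auto simp: a_def)
  have s01: "s n A \<in> {0..1}" for n A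
  proof -
    have "(\<Sum>k\<le>n. a (N + k) A) \<le> (\<Sum>k\<le>n. 1)" using a01 by (intro sum_mono)
    thus ?thesis using a01 by (auto simp: s_def divide_simps intro!: sum_nonneg)
  qed
  have a_add: "a k (A \<union> B) = a k A + a k B" if "A \<in> sets M" "B \<in> sets M" "A \<inter> B = {}" for k A B
    unfolding a_def using that fk_sets
    by (subst finite_measure_Union[symmetric]) (auto intro!: arg_cong[where f = prob])
  have s_add: "s n (A \<union> B) = s n A + s n B" if "A \<in> sets M" "B \<in> sets M" "A \<inter> B = {}" for n A B
    unfolding s_def using a_add[OF that] by (simp add: sum.distrib add_divide_distrib)
  have s_avg: "real (Suc n) * s n A = (\<Sum>k\<le>n. a (N + k) A)" for n A by (simp add: s_def)
  have s_le: "s n A \<le> C * prob A" if "A \<in> sets M" for n A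
  proof -
    have "(\<Sum>k\<le>n. a (N + k) A) \<le> (\<Sum>k\<le>n. C * prob A)"
      unfolding a_def using C that by (intro sum_mono)
    hence "real (Suc n) * s n A \<le> real (Suc n) * (C * prob A)" unfolding s_avg by simp
    thus ?thesis by (subst (asm) mult_le_cancel_left_pos) auto
  qed
  have s_ge: "c * prob A \<le> s n A" if "A \<in> sets M" for n A
  proof -
    have "(\<Sum>k\<le>n. c * prob A) \<le> (\<Sum>k\<le>n. a (N + k) A)"
      unfolding a_def using c that by (intro sum_mono) auto
    hence "real (Suc n) * (c * prob A) \<le> real (Suc n) * s n A" unfolding s_avg by simp
    thus ?thesis by (subst (asm) mult_le_cancel_left_pos) auto
  qed
  \<comment> \<open>Taking a preimage shifts time by one, so the sum telescopes to two end terms in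
    the unit interval.\<close>
  have s_inv: "\<bar>s n (f -` A \<inter> space M) - s n A\<bar> \<le> 1 / real (Suc n)" if "A \<in> sets M" for n A
  proof -
    have aS: "a k (f -` A \<inter> space M) = a (Suc k) A" for k
    proof -
      have "(f ^^ k) -` (f -` A \<inter> space M) \<inter> space M = (f ^^ Suc k) -` A \<inter> space M"
        using measurable_space[OF fk] by (auto simp: funpow_swap1[symmetric])
      thus ?thesis by (simp only: a_def)
    qed
    have "(\<Sum>k\<le>n. a (N + k) (f -` A \<inter> space M)) - (\<Sum>k\<le>n. a (N + k) A)
        = (\<Sum>k\<le>n. a (N + Suc k) A - a (N + k) A)"
      by (simp add: aS sum_subtractf)
    also have "\<dots> = a (N + Suc n) A - a N A"
      using sum_telescope''[of 0 "Suc n" "\<lambda>k. a (N + k) A"]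
      by (induction n) simp_all
    finally have "s n (f -` A \<inter> space M) - s n A = (a (N + Suc n) A - a N A) / real (Suc n)"
      by (simp add: s_def diff_divide_distrib[symmetric])
    moreover have "\<bar>a (N + Suc n) A - a N A\<bar> \<le> 1"
      using a01[of "N + Suc n" A] a01[of N A] by linarith
    ultimately show ?thesis by (simp add: divide_right_mono)
  qed
  have "compactin (product_topology (\<lambda>_. euclidean) UNIV) (PiE UNIV (\<lambda>_ :: 'a set. {0..1 :: real}))"
    by (subst compactin_PiE) auto
  hence "compact (PiE UNIV (\<lambda>_ :: 'a set. {0..1 :: real}))"
    by (simp add: euclidean_product_topology)
  moreover have "eventually (\<lambda>g. g \<in> PiE UNIV (\<lambda>_. {0..1})) (filtermap s sequentially)"
    using s01 by (auto simp: eventually_filtermap PiE_def)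
  \<comment> \<open>The averages lie in a compact product of unit intervals. The filter
    \<open>L\<close> below refines their tail filter and converges to m, which gives limits at all
    sets simultaneously.\<close>
  ultimately obtain m where m: "inf (nhds m) (filtermap s sequentially) \<noteq> bot"
    unfolding compact_filter by (metis filtermap_bot_iff sequentially_bot)
  define L where "L = inf (nhds m) (filtermap s sequentially)"
  have L: "L \<noteq> bot" using m by (simp add: L_def)
  have ev: "eventually P L" if "\<And>n. P (s n)" for P
    using that by (auto simp: L_def intro!: filter_leD[OF inf_le2] simp: eventually_filtermap)
  have lim: "((\<lambda>g. g A) \<longlongrightarrow> m A) L" for A
  proof (rule tendsto_mono)
    show "L \<le> nhds m" by (simp add: L_def)
    show "((\<lambda>g. g A) \<longlongrightarrow> m A) (nhds m)"
    proof (rule topological_tendstoI)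
      fix S :: "real set" assume S: "open S" "m A \<in> S"
      have "open ((\<lambda>g :: 'a set \<Rightarrow> real. g A) -` S)"
        using S(1) continuous_on_product_coordinates by (rule open_vimage)
      thus "eventually (\<lambda>g. g A \<in> S) (nhds m)"
        using S(2) unfolding eventually_nhds by (intro exI[of _ "(\<lambda>g. g A) -` S"]) auto
    qed
  qed
  have m_bounds: "0 \<le> m A" "m A \<le> 1" for A
    using tendsto_lowerbound[OF lim _ L, of 0] tendsto_upperbound[OF lim _ L, of _ 1] s01 ev by auto
  have m_le: "m A \<le> C * prob A" if "A \<in> sets M" for A
    using tendsto_upperbound[OF lim ev L] s_le that by blast
  have m_ge: "c * prob A \<le> m A" if "A \<in> sets M" for A
    using tendsto_lowerbound[OF lim ev L] s_ge that by blast
  have m_add: "m (A \<union> B) = m A + m B" if "A \<in> sets M" "B \<in> sets M" "A \<inter> B = {}" for A B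
  proof (rule tendsto_unique[OF L lim])
    have "eventually (\<lambda>g. g A + g B = g (A \<union> B)) L" using s_add[OF that] by (intro ev) auto
    thus "((\<lambda>g. g (A \<union> B)) \<longlongrightarrow> m A + m B) L"
      using tendsto_add[OF lim[of A] lim[of B]] by (simp cong: tendsto_cong)
  qed
  have m_inv: "m (f -` A \<inter> space M) = m A" if A: "A \<in> sets M" for A
  proof -
    have "(\<lambda>n. s n (f -` A \<inter> space M) - s n A) \<longlonglongrightarrow> 0"
      by (rule Lim_null_comparison[OF _ lim_inverse_n'[THEN LIMSEQ_Suc]]) (use s_inv[OF A] in auto)
    hence "((\<lambda>g. g (f -` A \<inter> space M) - g A) \<longlongrightarrow> 0) (filtermap s sequentially)"
      by (simp add: filterlim_filtermap)
    hence "((\<lambda>g. g (f -` A \<inter> space M) - g A) \<longlongrightarrow> 0) L"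
      by (rule tendsto_mono[rotated]) (simp add: L_def)
    thus ?thesis
      using tendsto_unique[OF L _ tendsto_diff[OF lim lim]] by fastforce
  qed
  have m_one: "m (space M) = 1"
  proof -
    have "s n (space M) = 1" for n
    proof -
      have "(f ^^ k) -` space M \<inter> space M = space M" for k using measurable_space[OF fk] by auto
      hence "a k (space M) = 1" for k by (simp add: a_def prob_space)
      thus ?thesis by (simp add: s_def)
    qed
    hence "eventually (\<lambda>g. 1 = g (space M)) L" by (intro ev) auto
    hence "((\<lambda>g. g (space M)) \<longlongrightarrow> 1) L" by (rule tendsto_eventually[OF eventually_mono]) auto
    thus ?thesis using tendsto_unique[OF L lim] by blast
  qed
  define \<mu> where "\<mu> = measure_of (space M) (sets M) (\<lambda>A. ennreal (m A))"
  have "countably_additive (sets M) (\<lambda>A. ennreal (m A))"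
  proof (rule sets.empty_continuous_imp_countably_additive)
    have "m {} = m {} + m {}" using m_add[of "{}" "{}"] by simp
    thus "positive (sets M) (\<lambda>A. ennreal (m A))" by (simp add: positive_def)
    show "additive (sets M) (\<lambda>A. ennreal (m A))"
      using m_add m_bounds by (auto simp: additive_def ennreal_plus)
    fix A :: "nat \<Rightarrow> 'a set" assume A: "range A \<subseteq> sets M" "decseq A" "(\<Inter>i. A i) = {}"
    have "(\<lambda>i. prob (A i)) \<longlonglongrightarrow> prob (\<Inter>i. A i)" using A by (intro finite_Lim_measure_decseq) auto
    hence "(\<lambda>i. C * prob (A i)) \<longlonglongrightarrow> C * 0" using A by (intro tendsto_mult_left) simp
    hence "(\<lambda>i. m (A i)) \<longlonglongrightarrow> 0"
      using A m_bounds m_le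
      by (intro tendsto_sandwich[of "\<lambda>_. 0" "\<lambda>i. m (A i)" sequentially "\<lambda>i. C * prob (A i)" 0]) auto
    thus "(\<lambda>i. ennreal (m (A i))) \<longlonglongrightarrow> 0" using tendsto_ennrealI by fastforce
  qed auto
  moreover have "positive (sets M) (\<lambda>A. ennreal (m A))"
    using m_add[of "{}" "{}"] by (simp add: positive_def)
  ultimately have em: "emeasure \<mu> A = ennreal (m A)" if "A \<in> sets M" for A
    using that unfolding \<mu>_def by (intro emeasure_measure_of_sigma) (auto simp: sets.sigma_algebra_axioms)
  have sets: "sets \<mu> = sets M" and space: "space \<mu> = space M" by (simp_all add: \<mu>_def)
  show thesis
  proof (rule that[of \<mu>])
    show "prob_space \<mu>" by (rule prob_spaceI) (simp add: em space m_one)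
    show "invariant_measure \<mu> f" unfolding invariant_measure_def
      using f m_inv measurable_sets[OF f] by (auto simp: sets space em measurable_cong_sets[OF sets sets])
    show "c * prob A \<le> measure \<mu> A \<and> measure \<mu> A \<le> C * prob A" if "A \<in> sets M" for A
      using m_le[OF that] m_ge[OF that] m_bounds em[OF that] by (simp add: measure_def)
  qed (rule sets)
qed

section \<open>Convergence of the expansions\<close>

lemma tau_irrational: "x \<notin> \<rat> \<Longrightarrow> tau \<alpha> x \<notin> \<rat>"
proof
  assume x: "x \<notin> \<rat>" and t: "tau \<alpha> x \<in> \<rat>"
  have "1 / x = tau \<alpha> x + of_int \<lfloor>1 / x + \<alpha>\<rfloor>" by (simp add: tau_def)
  hence "1 / x \<in> \<rat>" using t by (metis Rats_add Rats_of_int)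
  thus False using x by (metis Rats_inverse inverse_eq_divide inverse_inverse_eq)
qed

lemma tau_pow_irrational: "x \<notin> \<rat> \<Longrightarrow> (tau \<alpha> ^^ n) x \<notin> \<rat>"
  by (induction n) (auto simp: tau_irrational)

text \<open>Numerator and denominator; a vanishing denominator stands for \<open>\<infinity>\<close>.\<close>

fun ratio :: "int list \<Rightarrow> int \<times> int" where
  "ratio [] = (0, 1)"
| "ratio (a # w) = (snd (ratio w), a * snd (ratio w) + fst (ratio w))"

text \<open>Ensures that a zero denominator really means \<infinity> and not an undetermined
  quotient.\<close>

lemma ratio_nonzero: "ratio w \<noteq> (0, 0)"
  by (induction w) (auto simp: prod_eq_iff)

lemma finite_fraction_ratio:
  "finite_fraction w = (if snd (ratio w) = 0 then \<infinity> else ereal (of_int (fst (ratio w)) / of_int (snd (ratio w))))"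
proof (induction w)
  case Nil
  show ?case by simp
next
  case (Cons a w)
  obtain p q where pq: "ratio w = (p, q)" by fastforce
  show ?case
  proof (cases "q = 0")
    case True
    \<comment> \<open>The inner fraction is \<infinity>, so its reciprocal after adding a is 0; the
      new pair is 0 over the nonzero p.\<close>
    hence "p \<noteq> 0" using ratio_nonzero[of w] pq by auto
    thus ?thesis using True Cons pq by (simp add: zero_ereal_def)
  next
    case False
    hence "finite_fraction (a # w) = 1 / ereal (of_int (a * q + p) / of_int q)"
      using Cons pq by (simp add: add_divide_distrib)
    also have "\<dots> = (if a * q + p = 0 then \<infinity> else ereal (of_int q / of_int (a * q + p)))"
    proof (cases "a * q + p = 0")
      case True
      hence "(of_int (a * q + p) :: real) / of_int q = 0" by (simp only: of_int_0 divide_eq_0_iff simp_thms)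
      thus ?thesis using True by (simp add: divide_ereal_def flip: zero_ereal_def)
    next
      case nz: False
      hence "(of_int (a * q + p) :: real) \<noteq> 0" using of_int_eq_0_iff by blast
      thus ?thesis using False nz by (simp add: one_ereal_def)
    qed
    finally show ?thesis using pq by simp
  qed
qed

text \<open>Since the first digit is \<open>1 / x - tau \<alpha> x\<close>, prepending it multiplies
  the signed error for \<open>tau \<alpha> x\<close> by -x.\<close>

lemma ratio_error:
  assumes "x \<notin> \<rat>"
  shows "\<bar>of_int (snd (ratio (digit_list \<alpha> n x))) * x - of_int (fst (ratio (digit_list \<alpha> n x)))\<bar>
    = (\<Prod>k\<le>n. \<bar>(tau \<alpha> ^^ k) x\<bar>)"
  using assms
proof (induction n arbitrary: x)
  case 0
  show ?case by (simp add: digit_list_def)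
next
  case (Suc n)
  obtain p q where pq: "ratio (digit_list \<alpha> n (tau \<alpha> x)) = (p, q)" by fastforce
  let ?a = "\<lfloor>1 / x + \<alpha>\<rfloor>"
  have x0: "x \<noteq> 0" using Suc.prems by auto
  have e: "of_int ?a = 1 / x - tau \<alpha> x" by (simp add: tau_def)
  have "of_int (?a * q + p) = (1 / x - tau \<alpha> x) * of_int q + of_int p"
    by (simp only: of_int_add of_int_mult e)
  hence "of_int (?a * q + p) * x - of_int q = - (x * (of_int q * tau \<alpha> x - of_int p))"
    by (simp only:) (use x0 in \<open>simp add: field_simps\<close>)
  hence "\<bar>of_int (?a * q + p) * x - of_int q\<bar> = \<bar>x\<bar> * \<bar>of_int q * tau \<alpha> x - of_int p\<bar>"
    by (simp only: abs_minus_cancel abs_mult)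
  also have "\<bar>of_int q * tau \<alpha> x - of_int p\<bar> = (\<Prod>k\<le>n. \<bar>(tau \<alpha> ^^ k) (tau \<alpha> x)\<bar>)"
    using Suc.IH[OF tau_irrational[OF Suc.prems, of \<alpha>]] pq by simp
  also have "\<bar>x\<bar> * \<dots> = (\<Prod>k\<le>Suc n. \<bar>(tau \<alpha> ^^ k) x\<bar>)"
    by (subst prod.atMost_Suc_shift) (simp add: funpow_swap1)
  finally show ?case using pq by (simp add: digit_list_Suc)
qed

text \<open>The strict bound by \<open>1\<close> excludes a vanishing denominator in \<open>ratio_error\<close>.\<close>

lemma prod_tau_le:
  assumes \<alpha>: "\<alpha> \<in> {0..1}" and x: "x \<in> {- \<alpha>..<1 - \<alpha>}" "x \<notin> \<rat>"
  shows "(\<Prod>k\<le>n. \<bar>(tau \<alpha> ^^ k) x\<bar>) \<le> (1 / 2) ^ (n div 2) \<and> (\<Prod>k\<le>n. \<bar>(tau \<alpha> ^^ k) x\<bar>) < 1"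
proof -
  let ?t = "\<lambda>k. (tau \<alpha> ^^ k) x"
  have range: "?t k \<in> {- \<alpha>..<1 - \<alpha>}" for k using x tau_range by (cases k) auto
  have irr: "?t k \<notin> \<rat>" for k using tau_pow_irrational x by blast
  have lt1: "\<bar>?t k\<bar> < 1" for k
  proof -
    \<comment> \<open>Only for \<alpha> = 1 does the half-open interval contain a point of modulus
      1, namely -1; irrationality excludes it.\<close>
    have "?t k \<noteq> -1" using irr[of k] by (metis Rats_1 Rats_minus_iff)
    thus ?thesis using range[of k] \<alpha> by (auto simp: abs_less_iff)
  qed
  have pair: "\<bar>?t k\<bar> * \<bar>?t (Suc k)\<bar> \<le> 1 / 2" for k
  proof -
    have nz: "?t k \<noteq> 0" using irr[of k] by auto
    have e: "of_int \<lfloor>1 / ?t k + \<alpha>\<rfloor> + ?t (Suc k) = 1 / ?t k" by (simp add: tau_def)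
    have "\<bar>?t k\<bar> * \<bar>?t (Suc k)\<bar> \<le> contraction \<alpha>"
      using pair_bound[OF \<alpha> _ _ lt1[of k], of "?t (Suc k)" "\<lfloor>1 / ?t k + \<alpha>\<rfloor>"] range[of k] range[of "Suc k"] nz e
      by auto
    thus ?thesis using contraction_bounds[OF \<alpha>] by linarith
  qed
  have nn: "0 \<le> (\<Prod>k\<le>n. \<bar>?t k\<bar>)" for n by (intro prod_nonneg) auto
  have "(\<Prod>k\<le>n. \<bar>?t k\<bar>) \<le> (1 / 2) ^ (n div 2) \<and> (\<Prod>k\<le>n. \<bar>?t k\<bar>) < 1"
  \<comment> \<open>Single factors may be close to 1; only products of two neighbours are at most
    1/2, hence steps of two.\<close>
  proof (induction n rule: induct_nat_012)
    case 0
    thus ?case using lt1[of 0] by simp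
  next
    case 1
    thus ?case using pair[of 0] by simp
  next
    case (ge2 n)
    have "(\<Prod>k\<le>Suc (Suc n). \<bar>?t k\<bar>) = (\<Prod>k\<le>n. \<bar>?t k\<bar>) * (\<bar>?t (Suc n)\<bar> * \<bar>?t (Suc (Suc n))\<bar>)"
      by (simp only: prod.atMost_Suc mult.assoc)
    also have "\<dots> \<le> (\<Prod>k\<le>n. \<bar>?t k\<bar>) * (1 / 2)" using pair[of "Suc n"] nn[of n] by (intro mult_left_mono)
    finally show ?case using ge2 nn[of n] by auto
  qed
  thus ?thesis .
qed

text \<open>If the denominator vanished, the error would be a nonzero integer in modulus, against
  its bound below 1. A nonzero integer denominator has modulus at least 1, so dividing by it does
  not enlarge the error.\<close>

lemma fractions_converge:
  assumes \<alpha>: "\<alpha> \<in> {0..1}" and x: "x \<in> {- \<alpha>..<1 - \<alpha>}" "x \<notin> \<rat>"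
  shows "(\<lambda>n. finite_fraction (digit_list \<alpha> n x)) \<longlonglongrightarrow> ereal x"
proof -
  define p where "p n = fst (ratio (digit_list \<alpha> n x))" for n
  define q where "q n = snd (ratio (digit_list \<alpha> n x))" for n
  have err: "\<bar>of_int (q n) * x - of_int (p n)\<bar> = (\<Prod>k\<le>n. \<bar>(tau \<alpha> ^^ k) x\<bar>)" for n
    unfolding p_def q_def by (rule ratio_error[OF x(2)])
  have q0: "q n \<noteq> 0" for n
  proof
    assume 0: "q n = 0"
    hence "p n \<noteq> 0" using ratio_nonzero[of "digit_list \<alpha> n x"] by (auto simp: p_def q_def prod_eq_iff)
    hence "\<bar>of_int (p n)\<bar> \<ge> (1::real)" by linarith
    moreover have "\<bar>of_int (p n)\<bar> < (1::real)" using err[of n] prod_tau_le[OF assms, of n] 0 by simp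
    ultimately show False by simp
  qed
  have "(\<lambda>n. of_int (p n) / of_int (q n)) \<longlonglongrightarrow> x"
  proof (rule LIM_zero_cancel, rule Lim_null_comparison)
    show "\<forall>\<^sub>F n in sequentially. norm (of_int (p n) / of_int (q n) - x) \<le> (1 / 2) ^ (n div 2)"
    proof (rule always_eventually, rule allI)
      fix n
      have "\<bar>of_int (q n)\<bar> \<ge> (1::real)" using q0[of n] by linarith
      moreover have "of_int (p n) / of_int (q n) - x = - (of_int (q n) * x - of_int (p n)) / of_int (q n)"
        using q0[of n] by (simp add: field_simps)
      hence "norm (of_int (p n) / of_int (q n) - x) = \<bar>of_int (q n) * x - of_int (p n)\<bar> / \<bar>of_int (q n)\<bar>"
        by (simp only: real_norm_def abs_divide abs_minus_cancel)
      ultimately have "norm (of_int (p n) / of_int (q n) - x) \<le> \<bar>of_int (q n) * x - of_int (p n)\<bar> / 1"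
        by (simp only: divide_left_mono)
      thus "norm (of_int (p n) / of_int (q n) - x) \<le> (1 / 2) ^ (n div 2)"
        using err[of n] prod_tau_le[OF assms, of n] by simp
    qed
    have "filterlim (\<lambda>n::nat. n div 2) sequentially sequentially"
      unfolding filterlim_at_top
    proof (rule allI)
      show "\<forall>\<^sub>F n in sequentially. Z \<le> n div 2" for Z :: nat
        by (rule eventually_sequentiallyI[of "2 * Z"]) auto
    qed
    thus "(\<lambda>n. (1 / 2 :: real) ^ (n div 2)) \<longlonglongrightarrow> 0"
      by (rule filterlim_compose[rotated]) (rule LIMSEQ_realpow_zero, auto)
  qed
  hence "(\<lambda>n. ereal (of_int (p n) / of_int (q n))) \<longlonglongrightarrow> ereal x" by simp
  moreover have "finite_fraction (digit_list \<alpha> n x) = ereal (of_int (p n) / of_int (q n))" for n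
    using finite_fraction_ratio[of "digit_list \<alpha> n x"] q0[of n] by (simp add: p_def q_def)
  ultimately show ?thesis by simp
qed

lemma K_nth: "x \<in> K \<alpha> \<longleftrightarrow> (\<forall>i. x $ i \<in> {- \<alpha> $ i..<1 - \<alpha> $ i})"
proof
  assume x: "\<forall>i. x $ i \<in> {- \<alpha> $ i..<1 - \<alpha> $ i}"
  have "0 \<le> x $ i + \<alpha> $ i \<and> x $ i + \<alpha> $ i < 1" for i
    using x[rule_format, of i] by auto
  thus "x \<in> K \<alpha>" unfolding K_def by (intro image_eqI[of _ _ "x + \<alpha>"]) auto
qed (auto simp: K_def)

lemma irrational_expansions:
  fixes \<alpha> :: "real^'n"
  assumes \<alpha>: "\<forall>i. \<alpha> $ i \<in> {0..1}" and x: "x \<in> K \<alpha>" "\<forall>i. x $ i \<notin> \<rat>"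
  shows "infinite_expansion \<alpha> x" "convergent_expansion \<alpha> x"
proof -
  show "infinite_expansion \<alpha> x"
    using tau_pow_irrational x(2) unfolding infinite_expansion_def zero_coord_def
    by (auto simp: T_pow_nth) (metis Rats_0)
  have d: "map (\<lambda>k. digit \<alpha> x k $ i) [0..<n] = digit_list (\<alpha> $ i) n (x $ i)" for i n
    by (simp add: digit_def next_digit_def digit_list_def T_pow_nth)
  show "convergent_expansion \<alpha> x"
    unfolding convergent_expansion_def
  proof (rule vec_tendstoI)
    fix i
    have "(\<lambda>n. finite_fraction (digit_list (\<alpha> $ i) n (x $ i))) \<longlonglongrightarrow> ereal (x $ i)"
      using \<alpha> x unfolding K_nth by (intro fractions_converge) auto
    thus "(\<lambda>n. (\<chi> i. finite_fraction (map (\<lambda>k. digit \<alpha> x k $ i) [0..<n])) $ i) \<longlonglongrightarrow> (\<chi> i. ereal (x $ i)) $ i"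
      by (simp add: d)
  qed
qed

section \<open>Exactness\<close>

text \<open>A density argument by covering. If A missed at least the proportion \<epsilon> of every
  box, it would do so for the union of a nonoverlapping cover of its part in
  \<open>Kvec \<alpha>\<close>; but the cover can be chosen with excess at most half of \<epsilon>
  times the mass of A.\<close>

lemma dense_box:
  assumes A: "A \<in> sets borel" and pos: "measure (unif_Kvec \<alpha>) A > 0" and \<epsilon>: "\<epsilon> > 0"
  obtains a b where "measure (unif_Kvec \<alpha>) (cbox a b) > 0"
    "measure (unif_Kvec \<alpha>) (cbox a b - A) < \<epsilon> * measure (unif_Kvec \<alpha>) (cbox a b)"
proof (rule ccontr)
  assume nt: "\<not> thesis"
  let ?m = "measure (unif_Kvec \<alpha>)"
  have far: "\<epsilon> * ?m (cbox a b) \<le> ?m (cbox a b - A)" for a b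
  proof (cases "?m (cbox a b) > 0")
    case True
    thus ?thesis using nt that[of a b] by fastforce
  next
    case False
    thus ?thesis by (simp add: zero_less_measure_iff)
  qed
  define S where "S = Kvec \<alpha> \<inter> A"
  have S: "S \<in> sets borel" using A by (simp add: S_def)
  have Ksub: "Kvec \<alpha> \<subseteq> cbox (- \<alpha>) (1 - \<alpha>)"
    by (auto simp: rect_def Kin_def mem_box_cart) (meson less_imp_le)+
  hence Ssub: "S \<subseteq> cbox (- \<alpha>) (1 - \<alpha>)" by (auto simp: S_def)
  have Slm: "S \<in> lmeasurable"
    using S Ssub bounded_subset[OF bounded_cbox Ssub] by (intro bounded_set_imp_lmeasurable) auto
  define e where "e = \<epsilon> * ?m A / 2"
  have e: "e > 0" using pos \<epsilon> by (simp add: e_def)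
  obtain \<D> where D: "countable \<D>"
    "\<And>K. K \<in> \<D> \<Longrightarrow> K \<subseteq> cbox (- \<alpha>) (1 - \<alpha>) \<and> K \<noteq> {} \<and> (\<exists>c d. K = cbox c d)"
    "pairwise (\<lambda>A B. interior A \<inter> interior B = {}) \<D>"
    "S \<subseteq> \<Union>\<D>" "\<Union>\<D> \<in> lmeasurable" "measure lebesgue (\<Union>\<D>) \<le> measure lebesgue S + e"
    using measurable_outer_intervals_bounded[OF Slm Ssub e] by metis
  \<comment> \<open>The covering boxes may share boundaries. Their interiors are disjoint, and the
    boundaries removed are null.\<close>
  let ?U = "\<Union>K\<in>\<D>. interior K"
  have Db: "K \<in> sets borel" if "K \<in> \<D>" for K using D(2)[OF that] by auto
  have U: "?U \<in> sets borel" by (intro borel_open open_UN) auto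
  have fr: "K - interior K \<in> null_sets (unif_Kvec \<alpha>)" if KD: "K \<in> \<D>" for K
  proof -
    obtain c d where cd: "K = cbox c d" using D(2)[OF KD] by blast
    have "emeasure (unif_Kvec \<alpha>) (K - interior K) \<le> emeasure lborel (K - interior K)"
      using cd by (subst emeasure_unif_Kvec) (auto intro!: emeasure_mono)
    also have "\<dots> = 0"
      unfolding cd interior_cbox by (subst emeasure_Diff) (auto simp: emeasure_lborel_box_eq emeasure_lborel_cbox_eq box_subset_cbox split: if_splits)
    finally show ?thesis using cd by (auto intro!: null_setsI)
  qed
  have "disjoint_family_on interior \<D>"
    using D(3) by (auto simp: disjoint_family_on_def pairwise_def)
  hence 1: "\<epsilon> * ?m ?U \<le> 1 * ?m (?U \<inter> - A)"
  proof (intro unif_Kvec.measure_UN_mono)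
    fix K assume K: "K \<in> \<D>"
    obtain c d where cd: "K = cbox c d" using D(2)[OF K] by blast
    have int_eq: "?m (interior K) = ?m K"
      using measure_Diff_null_set[OF _ fr[OF K], of K] Db[OF K]
      by (simp add: Diff_Diff_Int Int_absorb1 interior_subset)
    have eq: "K - A - (K - interior K) = interior K \<inter> - A" using interior_subset[of K] by blast
    have "K - A \<in> sets (unif_Kvec \<alpha>)" using Db[OF K] A by auto
    hence "?m (interior K \<inter> - A) = ?m (K - A)"
      using measure_Diff_null_set[OF _ fr[OF K], of "K - A"] unfolding eq by blast
    with int_eq show "\<epsilon> * ?m (interior K) \<le> 1 * ?m (interior K \<inter> - A)"
      using far[of c d] cd by simp
  qed (use A D(1) \<epsilon> in auto)
  have 2: "?m A \<le> ?m ?U"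
  proof -
    have n: "(\<Union>K\<in>\<D>. K - interior K) \<in> null_sets (unif_Kvec \<alpha>)" using D(1) fr by (rule null_sets_UN')
    have "?m A = ?m S" using A by (simp add: measure_unif_Kvec S_def)
    also have "\<dots> \<le> ?m (?U \<union> (\<Union>K\<in>\<D>. K - interior K))"
      using D(4) U n by (intro unif_Kvec.finite_measure_mono) auto
    also have "\<dots> = ?m ?U" using U n by (intro measure_Un_null_set) auto
    finally show ?thesis .
  qed
  have 3: "?m (?U \<inter> - A) \<le> e"
  proof -
    have "?m (?U \<inter> - A) \<le> measure lebesgue (\<Union>\<D> - S)"
    proof -
      have "?m (?U \<inter> - A) = measure lebesgue (Kvec \<alpha> \<inter> (?U \<inter> - A))"
        using U A by (simp add: measure_unif_Kvec)
      also have "\<dots> \<le> measure lebesgue (\<Union>\<D> - S)"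
      proof (rule measure_mono_fmeasurable)
        show "Kvec \<alpha> \<inter> (?U \<inter> - A) \<subseteq> \<Union>\<D> - S" using interior_subset by (auto simp: S_def)
        show "\<Union>\<D> - S \<in> lmeasurable" using D(5) Slm by (intro fmeasurable.Diff) auto
      qed (use U A in auto)
      finally show ?thesis .
    qed
    also have "\<dots> = measure lebesgue (\<Union>\<D>) - measure lebesgue S"
      using D(4,5) Slm by (intro measurable_measure_Diff) (auto simp: fmeasurableD)
    finally show ?thesis using D(6) by linarith
  qed
  have "\<epsilon> * ?m A \<le> \<epsilon> * ?m ?U" using 2 \<epsilon> by (intro mult_left_mono) auto
  hence "\<epsilon> * ?m A \<le> e" using 1 3 by linarith
  thus False using pos \<epsilon> by (simp add: e_def)
qed

text \<open>Mixing of a box \<open>Q\<close> in which \<open>A\<close> is dense, tested on the complement \<open>B\<close> of the \<open>n\<close>-th image of \<open>A\<close>: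
  the points of \<open>Q\<close> sent to \<open>B\<close> lie outside \<open>A\<close>, so \<open>B\<close> is small.\<close>

lemma images_fill_up:
  fixes \<alpha> :: "real^'n"
  assumes \<alpha>: "\<forall>i. \<alpha> $ i \<in> {0..1}" and A: "A \<in> sets borel" and pos: "measure (unif_Kvec \<alpha>) A > 0"
  shows "(\<lambda>n. measure (unif_Kvec \<alpha>) (- ((T \<alpha> ^^ n) ` A))) \<longlonglongrightarrow> 0"
proof (rule LIMSEQ_I)
  fix r :: real assume r: "r > 0"
  let ?m = "measure (unif_Kvec \<alpha>)"
  obtain c where c: "c > 0" and mix: "\<And>a b. \<exists>N. \<forall>n\<ge>N. \<forall>B\<in>sets borel.
     c * ?m (cbox a b) * ?m B \<le> ?m (cbox a b \<inter> (T \<alpha> ^^ n) -` B)"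
    using box_mixing[OF \<alpha>] by blast
  obtain a b where ab: "?m (cbox a b) > 0" "?m (cbox a b - A) < c * r * ?m (cbox a b)"
    using dense_box[OF A pos, of "c * r"] c r by auto
  obtain N where N: "\<And>n B. n \<ge> N \<Longrightarrow> B \<in> sets borel \<Longrightarrow>
     c * ?m (cbox a b) * ?m B \<le> ?m (cbox a b \<inter> (T \<alpha> ^^ n) -` B)" using mix[of a b] by blast
  have "?m (- ((T \<alpha> ^^ n) ` A)) < r" if n: "n \<ge> N" for n
  proof -
    let ?B = "- ((T \<alpha> ^^ n) ` A)"
    have B: "?B \<in> sets borel" using T_pow_image_borel[OF A] by auto
    have "c * ?m (cbox a b) * ?m ?B \<le> ?m (cbox a b \<inter> (T \<alpha> ^^ n) -` ?B)" using N[OF n B] .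
    also have "\<dots> \<le> ?m (cbox a b - A)" using A by (intro unif_Kvec.finite_measure_mono) auto
    also have "\<dots> < c * r * ?m (cbox a b)" by (rule ab)
    finally have "(c * ?m (cbox a b)) * ?m ?B < (c * ?m (cbox a b)) * r" by (simp add: mult_ac)
    thus ?thesis using c ab by (simp add: mult_less_cancel_left_pos)
  qed
  thus "\<exists>N. \<forall>n\<ge>N. norm (?m (- ((T \<alpha> ^^ n) ` A)) - 0) < r" by auto
qed

section \<open>Passage to the half-open box and conclusion\<close>

lemma K_rect: "K \<alpha> = rect (\<lambda>i. {- \<alpha> $ i..<1 - \<alpha> $ i})"
  by (auto simp: K_nth rect_def)

lemma K_borel [simp]: "K \<alpha> \<in> sets borel"
  by (simp add: K_rect)

lemma T_in_K: "T \<alpha> x \<in> K \<alpha>"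
  unfolding K_nth using tau_range by (simp add: T_nth)

text \<open>The half-open and open boxes both have measure 1, so they differ by a null set.\<close>

lemma emeasure_unif_Kvec_K:
  assumes A: "A \<in> sets borel" "A \<subseteq> K \<alpha>"
  shows "emeasure (unif_Kvec \<alpha>) A = emeasure lborel A"
proof -
  have K1: "emeasure lborel (K \<alpha>) = 1" by (simp add: K_rect emeasure_lborel_rect)
  have sub: "Kvec \<alpha> \<subseteq> K \<alpha>" by (auto simp: K_nth rect_def Kin_def less_imp_le)
  have "emeasure lborel (K \<alpha> - Kvec \<alpha>) = 0"
    using sub K1 by (subst emeasure_Diff) (auto simp: emeasure_Kvec)
  hence "K \<alpha> - Kvec \<alpha> \<in> null_sets lborel" by (intro null_setsI) (simp_all add: sets.Diff)
  hence n: "A - Kvec \<alpha> \<in> null_sets lborel"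
    by (rule null_sets_subset) (use A in auto)
  have "emeasure lborel ((Kvec \<alpha> \<inter> A) \<union> (A - Kvec \<alpha>)) = emeasure lborel (Kvec \<alpha> \<inter> A)"
    using n A by (intro emeasure_Un_null_set) auto
  moreover have "(Kvec \<alpha> \<inter> A) \<union> (A - Kvec \<alpha>) = A" by auto
  ultimately have "emeasure lborel A = emeasure lborel (Kvec \<alpha> \<inter> A)" by simp
  thus ?thesis using A by (simp add: emeasure_unif_Kvec)
qed

text \<open>The invariant measure is first built on the whole space, where \<open>T \<alpha>\<close>
  is total, and then restricted to \<open>K \<alpha>\<close>.\<close>

lemma exact_measure_exists:
  fixes \<alpha> :: "real^'n"
  assumes \<alpha>: "\<forall>i. \<alpha> $ i \<in> {0..1}"
  shows "\<exists>\<mu>. equivalent_measures \<mu> (restrict_space lborel (K \<alpha>)) \<and> exact \<mu> (T \<alpha>)"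
proof -
  let ?m = "measure (unif_Kvec \<alpha>)"
  obtain C where C: "C \<ge> 0" "\<And>n B. B \<in> sets borel \<Longrightarrow> ?m ((T \<alpha> ^^ n) -` B) \<le> C * ?m B"
    using T_vimage_le[OF \<alpha>] by blast
  obtain c0 where c0: "c0 > 0" and mix: "\<And>a b. \<exists>N. \<forall>n\<ge>N. \<forall>B\<in>sets borel.
     c0 * ?m (cbox a b) * ?m B \<le> ?m (cbox a b \<inter> (T \<alpha> ^^ n) -` B)"
    using box_mixing[OF \<alpha>] by blast
  \<comment> \<open>Mixing for a box of full mass bounds the measures of preimages from below for
    all large times, which gives the lower domination of the invariant measure.\<close>
  have one: "?m (cbox (- \<alpha>) (1 - \<alpha>)) = 1"
  proof -
    have "cbox (- \<alpha>) (1 - \<alpha>) = rect (\<lambda>i. {- \<alpha> $ i..1 - \<alpha> $ i})" by (auto simp: rect_def mem_box_cart)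
    moreover have "measure (unif_Kin (\<alpha> $ i)) {- \<alpha> $ i..1 - \<alpha> $ i} = 1" for i
    proof -
      have "Kin (\<alpha> $ i) \<inter> {- \<alpha> $ i..1 - \<alpha> $ i} = Kin (\<alpha> $ i)" by (auto simp: Kin_def)
      moreover have "measure lborel (Kin (\<alpha> $ i)) = 1" by (simp add: measure_def emeasure_Kin)
      ultimately show ?thesis by (simp add: measure_unif_Kin)
    qed
    ultimately show ?thesis by (simp add: measure_unif_Kvec_rect)
  qed
  obtain N where N: "\<And>n B. n \<ge> N \<Longrightarrow> B \<in> sets borel \<Longrightarrow> c0 * ?m B \<le> ?m ((T \<alpha> ^^ n) -` B)"
  proof -
    obtain N where N: "\<And>n B. n \<ge> N \<Longrightarrow> B \<in> sets borel \<Longrightarrow>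
       c0 * ?m B \<le> ?m (cbox (- \<alpha>) (1 - \<alpha>) \<inter> (T \<alpha> ^^ n) -` B)"
      using mix[of "- \<alpha>" "1 - \<alpha>"] one by auto
    have "c0 * ?m B \<le> ?m ((T \<alpha> ^^ n) -` B)" if "n \<ge> N" "B \<in> sets borel" for n B
      using N[OF that] unif_Kvec.finite_measure_mono[of "cbox (- \<alpha>) (1 - \<alpha>) \<inter> (T \<alpha> ^^ n) -` B" "(T \<alpha> ^^ n) -` B" \<alpha>] that
      by fastforce
    thus thesis using that by blast
  qed
  obtain \<mu>0 where sets0: "sets \<mu>0 = sets borel" and prob0: "prob_space \<mu>0" and inv0: "invariant_measure \<mu>0 (T \<alpha>)"
    and bounds: "\<And>A. A \<in> sets borel \<Longrightarrow> c0 * ?m A \<le> measure \<mu>0 A \<and> measure \<mu>0 A \<le> C * ?m A"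
  proof (rule unif_Kvec.invariant_measure_exists[of "T \<alpha>" \<alpha> C N c0])
    show "T \<alpha> \<in> measurable (unif_Kvec \<alpha>) (unif_Kvec \<alpha>)" by measurable
  qed (use C N in auto)
  interpret \<mu>0: prob_space \<mu>0 by (rule prob0)
  have sp0: "space \<mu>0 = UNIV" using sets_eq_imp_space_eq[OF sets0] by simp
  have null: "measure \<mu>0 A = 0" if "A \<in> sets borel" "A \<inter> K \<alpha> = {}" for A
  proof -
    have "Kvec \<alpha> \<inter> A = {}" using that(2) by (auto simp: K_nth rect_def Kin_def less_imp_le)
    hence "?m A = 0" using that by (simp add: measure_unif_Kvec)
    thus ?thesis using bounds[OF that(1)] by (simp add: antisym)
  qed
  have restr: "measure \<mu>0 (A \<inter> K \<alpha>) = measure \<mu>0 A" if "A \<in> sets borel" for A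
  proof -
    have "measure \<mu>0 A = measure \<mu>0 (A \<inter> K \<alpha>) + measure \<mu>0 (A - K \<alpha>)"
      using that by (subst \<mu>0.finite_measure_Union[symmetric]) (auto simp: sets0 intro!: arg_cong[where f = "measure \<mu>0"])
    moreover have "A - K \<alpha> \<in> sets borel" "(A - K \<alpha>) \<inter> K \<alpha> = {}" using that by auto
    ultimately show ?thesis using null by simp
  qed
  \<comment> \<open>Nothing is lost: domination by the uniform measure makes the complement of
    \<open>K \<alpha>\<close> null.\<close>
  define \<mu> where "\<mu> = restrict_space \<mu>0 (K \<alpha>)"
  have sets: "sets \<mu> = sets (restrict_space lborel (K \<alpha>))"
    unfolding \<mu>_def by (rule sets_restrict_space_cong) (simp add: sets0)
  have mem: "A \<in> sets \<mu> \<longleftrightarrow> A \<in> sets borel \<and> A \<subseteq> K \<alpha>" for A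
    unfolding \<mu>_def by (subst sets_restrict_space_iff) (auto simp: sets0)
  have em: "emeasure \<mu> A = ennreal (measure \<mu>0 A)" if "A \<in> sets \<mu>" for A
    using that mem unfolding \<mu>_def
    by (subst emeasure_restrict_space) (auto simp: sets0 sp0 \<mu>0.emeasure_eq_measure)
  have me: "measure \<mu> A = measure \<mu>0 A" if "A \<in> sets \<mu>" for A
    using em[OF that] by (simp add: measure_def)
  have sp: "space \<mu> = K \<alpha>" by (simp add: \<mu>_def space_restrict_space sp0)
  have "prob_space \<mu>"
  proof (rule prob_spaceI)
    have "measure \<mu>0 (K \<alpha>) = 1" using restr[of UNIV] \<mu>0.prob_space sp0 by simp
    thus "emeasure \<mu> (space \<mu>) = 1" by (simp add: sp em mem)
  qed
  moreover have "invariant_measure \<mu> (T \<alpha>)"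
    unfolding invariant_measure_def
  proof (intro conjI ballI)
    show "T \<alpha> \<in> measurable \<mu> \<mu>"
    proof (rule measurableI)
      fix A assume "A \<in> sets \<mu>"
      thus "T \<alpha> -` A \<inter> space \<mu> \<in> sets \<mu>" using vimage_T_pow[of A 1 \<alpha>] by (auto simp: mem sp)
    qed (simp add: sp T_in_K)
    fix A assume A: "A \<in> sets \<mu>"
    have v: "T \<alpha> -` A \<in> sets borel" using A vimage_T_pow[of A 1 \<alpha>] by (simp add: mem)
    have "emeasure \<mu> (T \<alpha> -` A \<inter> space \<mu>) = ennreal (measure \<mu>0 (T \<alpha> -` A \<inter> K \<alpha>))"
      using v by (subst em) (auto simp: sp mem)
    also have "\<dots> = ennreal (measure \<mu>0 (T \<alpha> -` A))" using restr[OF v] by simp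
    also have "measure \<mu>0 (T \<alpha> -` A) = measure \<mu>0 A"
      using inv0 A unfolding invariant_measure_def by (simp add: sets0 sp0 mem measure_def)
    finally show "emeasure \<mu> (T \<alpha> -` A \<inter> space \<mu>) = emeasure \<mu> A" using A by (simp add: em)
  qed
  moreover have "(\<lambda>n. measure \<mu> ((T \<alpha> ^^ n) ` A)) \<longlonglongrightarrow> 1" if A: "A \<in> sets \<mu>" "measure \<mu> A > 0" for A
  proof -
    have Ab: "A \<in> sets borel" "A \<subseteq> K \<alpha>" using A(1) mem by auto
    have "C * ?m A > 0" using A me bounds[OF Ab(1)] by auto
    hence pos: "?m A > 0" by (simp add: zero_less_measure_iff zero_less_mult_iff)
    have img: "(T \<alpha> ^^ n) ` A \<in> sets borel" "(T \<alpha> ^^ n) ` A \<subseteq> K \<alpha>" for n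
      using T_pow_image_borel[OF Ab(1)] Ab(2) T_in_K by (auto, cases n, auto)
    have B: "- ((T \<alpha> ^^ n) ` A) \<in> sets borel" for n using img(1) by (rule borel_comp)
    \<comment> \<open>The complements of the images are small for the uniform measure, hence also
      for the invariant measure, which is at most C times as large.\<close>
    have "(\<lambda>n. C * ?m (- ((T \<alpha> ^^ n) ` A))) \<longlonglongrightarrow> C * 0"
      using images_fill_up[OF \<alpha> Ab(1) pos] by (rule tendsto_mult_left)
    hence lim: "(\<lambda>n. C * ?m (- ((T \<alpha> ^^ n) ` A))) \<longlonglongrightarrow> 0" by simp
    have "(\<lambda>n. measure \<mu>0 (- ((T \<alpha> ^^ n) ` A))) \<longlonglongrightarrow> 0"
    proof (rule tendsto_sandwich[OF _ _ tendsto_const lim])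
      show "\<forall>\<^sub>F n in sequentially. measure \<mu>0 (- ((T \<alpha> ^^ n) ` A)) \<le> C * ?m (- ((T \<alpha> ^^ n) ` A))"
        using bounds[OF B] by simp
    qed simp
    hence "(\<lambda>n. 1 - measure \<mu>0 (- ((T \<alpha> ^^ n) ` A))) \<longlonglongrightarrow> 1 - 0" by (intro tendsto_diff tendsto_const)
    moreover have "1 - measure \<mu>0 (- ((T \<alpha> ^^ n) ` A)) = measure \<mu> ((T \<alpha> ^^ n) ` A)" for n
      using \<mu>0.prob_compl[of "(T \<alpha> ^^ n) ` A"] img[of n]
      by (simp add: sets0 sp0 me mem Compl_eq_Diff_UNIV)
    ultimately show ?thesis by simp
  qed
  ultimately have "exact \<mu> (T \<alpha>)" unfolding exact_def by blast
  moreover have "equivalent_measures \<mu> (restrict_space lborel (K \<alpha>))"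
    unfolding equivalent_measures_def
  proof (intro conjI exI ballI)
    \<comment> \<open>C serves one direction and \<open>1 / c0\<close> the other; the maximum with 1
      meets the requirement on the constant.\<close>
    define D where "D = max 1 (max C (1 / c0))"
    show "D \<ge> 1" by (simp add: D_def)
    have D0: "D > 0" "C \<le> D" "1 / c0 \<le> D" by (auto simp: D_def)
    fix A assume A: "A \<in> sets \<mu>"
    hence Ab: "A \<in> sets borel" "A \<subseteq> K \<alpha>" using mem by auto
    have leb: "emeasure (restrict_space lborel (K \<alpha>)) A = ennreal (?m A)"
      using Ab emeasure_unif_Kvec_K[OF Ab] by (subst emeasure_restrict_space) (auto simp: unif_Kvec.emeasure_eq_measure)
    have "measure \<mu>0 A \<le> D * ?m A"
      using bounds[OF Ab(1)] D0 by (meson measure_nonneg mult_right_mono order_trans)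
    hence "1 / D * measure \<mu>0 A \<le> ?m A" using D0 by (simp add: field_simps)
    thus "ennreal (1 / D) * emeasure \<mu> A \<le> emeasure (restrict_space lborel (K \<alpha>)) A"
      using D0 A by (simp add: em leb ennreal_mult'[symmetric])
    have "?m A \<le> 1 / c0 * measure \<mu>0 A" using bounds[OF Ab(1)] c0 by (simp add: field_simps)
    also have "\<dots> \<le> D * measure \<mu>0 A" using D0 by (intro mult_right_mono) auto
    finally show "emeasure (restrict_space lborel (K \<alpha>)) A \<le> ennreal D * emeasure \<mu> A"
      using D0 A by (simp add: em leb ennreal_mult'[symmetric])
  qed (rule sets)
  ultimately show ?thesis by blast
qed

theorem theorem3:
  fixes \<alpha> :: "real^'n"
  assumes "\<forall>i. \<alpha> $ i \<in> {0..1}"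
  shows "(\<exists>\<mu>. equivalent_measures \<mu> (restrict_space lborel (K \<alpha>)) \<and> exact \<mu> (T \<alpha>)) \<and>
         (\<forall>x\<in>K \<alpha>. (\<forall>i. x $ i \<notin> \<rat>) \<longrightarrow> infinite_expansion \<alpha> x \<and> convergent_expansion \<alpha> x)"
  using exact_measure_exists[OF assms] irrational_expansions[OF assms] by blast

end
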